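(* Let $\varphi=(\varphi_1,\varphi_2,\varphi_3,\varphi_4)$ be a function in $L^p(\partial D'_\beta)$. Then, for every $p\in(1,\infty)$, $$\lim_{(t,s)\to(\frac\pi2,\beta-\frac\pi2)}\big\|S\varphi[\cdot+i(s+t),e^{\frac s2}e^{2\pi i\cdot}]-\widetilde{S\varphi}_1\big\|_{L^p(\mathbb R\times\mathbb T)}=0,$$ where $(t,s)\in[0,\frac\pi2)\times[0,\beta-\frac\pi2)$.
   Context: Fix $\beta>\frac{\pi}{2}$, and let $\mathbb T=\mathbb R/\mathbb Z$. Let $$D'_\beta=\{(z_1,z_2)\in\mathbb C^2: |\operatorname{Im}z_1-\log|z_2|^2|<\tfrac{\pi}{2},\ |\log|z_2|^2|<\beta-\tfrac{\pi}{2}\}.$$ Put $(\eta_1,\eta_2,\eta_3,\eta_4)=(\beta,\beta-\pi,-\beta,-(\beta-\pi))$ and $(\sigma_1,\sigma_2,\sigma_3,\sigma_4)=(1,1,-1,-1)$. The distinguished boundary is $\partial D'_\beta=\bigcup_{\ell=1}^4E_\ell$, $E_\ell=\{(x+i\eta_\ell,e^{\frac{\sigma_\ell}2(\beta-\frac\pi2)}e^{2\pi i\theta}):x\in\mathbb R,\theta\in\mathbb T\}$, each $E_\ell$ identified with $\mathbb R\times\mathbb T$. A function on $\partial D'_\beta$ is a vector $\varphi=(\varphi_1,\dots,\varphi_4)$ of functions on $\mathbb R\times\mathbb T$, with $\|\varphi\|^p_{L^p(\partial D'_\beta)}=\sum_\ell\|\varphi_\ell\|^p_{L^p(\mathbb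 R\times\mathbb T)}$. For $p\in(1,\infty)$, $H^p(D'_\beta)$ is the space of holomorphic $F$ on $D'_\beta$ such that $\|F\|^p_{H^p(D'_\beta)}=\sup_{(t,s)\in[0,\frac\pi2)\times[0,\beta-\frac\pi2)}\mathcal L_pF(t,s)<\infty$, where $\mathcal L_pF(t,s)$ is the sum of the four integrals $\int_{\mathbb R}\int_0^1|F(x\pm i(s+t),e^{\pm\frac s2}e^{2\pi i\theta})|^p\,d\theta\,dx$ and $\int_{\mathbb R}\int_0^1|F(x\pm i(s-t),e^{\pm\frac s2}e^{2\pi i\theta})|^p\,d\theta\,dx$ (same sign in both arguments). $\mathcal F_{\mathbb R}\psi(\xi,\hat j)$ denotes the Fourier transform in the first variable of the $j$-th Fourier coefficient (w.r.t. $e^{2\pi ij\gamma}$) in the second variable of $\psi(x,\gamma)$, and $\mathcal F^{-1}_{\mathbb R}$ the inverse Fourier transform in the first variable. For $\varphi$ in the dense class of those $\varphi$ with $\varphi_\ell(x,\gamma)=\sum_{|j|<N}\varphi_\ell(x,j)e^{2\pi ij\gamma}$, $\varphi_\ell(\cdot,j)\in C_0^\infty(\mathbb R)$, define for $(u+iv,re^{2\pi i\gamma})\in D'_\beta$ $$S\varphi(u+iv,re^{2\pi i\gamma})=\frac14\sum_{m=1}^4\sum_{j\in\mathbb Z}r^je^{\frac{j\sigma_m}2(\beta-\frac\pi2)}e^{2\pi ij\gamma}\mathcal F^{-1}_{\mathbb R}\left[\frac{e^{-(v+\eta_m)(\cdot)}\mathcal F_{\mathbb R}\varphi_m(\cdot,\hat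 j)}{\cosh[\pi\cdot]\cosh[(2\beta-\pi)(\cdot-\frac j2)]}\right](u),$$ and (as a function of $(x,\gamma)\in\mathbb R\times\mathbb T\cong E_1$) $$\widetilde{S\varphi}_1(x,\gamma)=\frac14\sum_{m=1}^4\sum_{j\in\mathbb Z}e^{\frac{j(1+\sigma_m)}2(\beta-\frac\pi2)}e^{2\pi ij\gamma}\mathcal F^{-1}_{\mathbb R}\left[\frac{e^{-(\beta+\eta_m)(\cdot)}\mathcal F_{\mathbb R}\varphi_m(\cdot,\hat j)}{\cosh[\pi\cdot]\cosh[(2\beta-\pi)(\cdot-\frac j2)]}\right](x).$$ For general $\varphi\in L^p(\partial D'_\beta)$, $S\varphi\in H^p(D'_\beta)$ and $\widetilde{S\varphi}_1\in L^p(\mathbb R\times\mathbb T)$ are understood through the bounded extensions by density of these operators to $L^p(\partial D'_\beta)$. *)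

theory Defs
  imports "HOL-Analysis.Analysis"
begin

(* The condition on the second coordinate is needed because ln 0 = 0 in HOL, whereas
   log|0|^2 = - infinity in the mathematical definition. *)
definition Dprime :: "real \<Rightarrow> (complex \<times> complex) set" where
  "Dprime \<beta> = {(z1, z2). z2 \<noteq> 0 \<and> \<bar>Im z1 - ln ((cmod z2)\<^sup>2)\<bar> < pi / 2
                        \<and> \<bar>ln ((cmod z2)\<^sup>2)\<bar> < \<beta> - pi / 2}"

definition eta :: "real \<Rightarrow> nat \<Rightarrow> real" where
  "eta \<beta> l = (if l = 1 then \<beta> else if l = 2 then \<beta> - pi
              else if l = 3 then - \<beta> else - (\<beta> - pi))"

definition sigma :: "nat \<Rightarrow> real" where
  "sigma l = (if l = 1 \<or> l = 2 then 1 else - 1)"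

(* R x (R/Z), with R/Z represented by its fundamental domain [0,1). *)
definition RT :: "(real \<times> real) measure" where
  "RT = lborel \<Otimes>\<^sub>M restrict_space lborel {0..<1}"

definition root_ennreal :: "real \<Rightarrow> ennreal \<Rightarrow> ennreal" where
  "root_ennreal p a = (if a = \<infinity> then \<infinity> else ennreal (enn2real a powr (1 / p)))"

definition RT_norm_pow :: "real \<Rightarrow> (real \<times> real \<Rightarrow> complex) \<Rightarrow> ennreal" where
  "RT_norm_pow p f = (\<integral>\<^sup>+ w. ennreal (cmod (f w) powr p) \<partial>RT)"

definition RT_norm :: "real \<Rightarrow> (real \<times> real \<Rightarrow> complex) \<Rightarrow> ennreal" where
  "RT_norm p f = root_ennreal p (RT_norm_pow p f)"

definition RT_Lp :: "real \<Rightarrow> (real \<times> real \<Rightarrow> complex) set" where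
  "RT_Lp p = {f \<in> borel_measurable RT. RT_norm p f < \<infinity>}"

definition bdry_norm :: "real \<Rightarrow> (nat \<Rightarrow> real \<times> real \<Rightarrow> complex) \<Rightarrow> ennreal" where
  "bdry_norm p \<phi> = root_ennreal p (\<Sum>l\<in>{1..4}. RT_norm_pow p (\<phi> l))"

definition bdry_Lp :: "real \<Rightarrow> (nat \<Rightarrow> real \<times> real \<Rightarrow> complex) set" where
  "bdry_Lp p = {\<phi>. (\<forall>l\<in>{1..4}. \<phi> l \<in> borel_measurable RT) \<and> bdry_norm p \<phi> < \<infinity>}"

definition holomorphic2_on :: "(complex \<times> complex \<Rightarrow> complex) \<Rightarrow> (complex \<times> complex) set \<Rightarrow> bool" where
  "holomorphic2_on F D \<longleftrightarrow>
     (\<forall>z\<in>D. \<exists>a b. (F has_derivative (\<lambda>(h, k). a * h + b * k)) (at z within D))"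

definition slice :: "(complex \<times> complex \<Rightarrow> complex) \<Rightarrow> real \<Rightarrow> real \<Rightarrow> real \<times> real \<Rightarrow> complex" where
  "slice F v s = (\<lambda>(x, \<theta>). F (Complex x v, complex_of_real (exp (s / 2)) * cis (2 * pi * \<theta>)))"

definition Hp_L :: "real \<Rightarrow> (complex \<times> complex \<Rightarrow> complex) \<Rightarrow> real \<Rightarrow> real \<Rightarrow> ennreal" where
  "Hp_L p F t s =
     RT_norm_pow p (slice F (s + t) s) + RT_norm_pow p (slice F (- (s + t)) (- s))
   + RT_norm_pow p (slice F (s - t) s) + RT_norm_pow p (slice F (- (s - t)) (- s))"

definition Hp_norm :: "real \<Rightarrow> real \<Rightarrow> (complex \<times> complex \<Rightarrow> complex) \<Rightarrow> ennreal" where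
  "Hp_norm p \<beta> F =
     root_ennreal p (SUP (t, s) \<in> {0..<pi / 2} \<times> {0..<\<beta> - pi / 2}. Hp_L p F t s)"

definition Hp :: "real \<Rightarrow> real \<Rightarrow> (complex \<times> complex \<Rightarrow> complex) set" where
  "Hp p \<beta> = {F. holomorphic2_on F (Dprime \<beta>) \<and> Hp_norm p \<beta> F < \<infinity>}"

(* g n is the n-th derivative of f. *)
definition C0_infinity :: "(real \<Rightarrow> complex) \<Rightarrow> bool" where
  "C0_infinity f \<longleftrightarrow>
     (\<exists>g :: nat \<Rightarrow> real \<Rightarrow> complex. g 0 = f \<and>
        (\<forall>n x. (g n has_vector_derivative g (Suc n) x) (at x))) \<and>
     (\<exists>K. compact K \<and> (\<forall>x. x \<notin> K \<longrightarrow> f x = 0))"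

definition dense_class :: "(nat \<Rightarrow> real \<times> real \<Rightarrow> complex) set" where
  "dense_class = {\<phi>. \<exists>(N::nat) (c :: nat \<Rightarrow> real \<Rightarrow> int \<Rightarrow> complex). \<forall>l\<in>{1..4}.
      (\<forall>j. C0_infinity (\<lambda>x. c l x j)) \<and>
      (\<forall>x \<gamma>. \<phi> l (x, \<gamma>) = (\<Sum>j | \<bar>j\<bar> < int N. c l x j * cis (2 * pi * of_int j * \<gamma>)))}"

definition fourier_coeff :: "(real \<times> real \<Rightarrow> complex) \<Rightarrow> int \<Rightarrow> real \<Rightarrow> complex" where
  "fourier_coeff \<psi> j x = (LINT \<gamma>:{0..<1}|lborel. \<psi> (x, \<gamma>) * cis (- 2 * pi * of_int j * \<gamma>))"

(* The frequency convention e^(-i x xi) is the one for which e^(-v xi) is the symbol of the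
   holomorphic shift u |-> u + i v; the factor 1/sqrt(2 pi) cancels in all uses below. *)
definition fourier :: "(real \<Rightarrow> complex) \<Rightarrow> real \<Rightarrow> complex" where
  "fourier f \<xi> = complex_of_real (1 / sqrt (2 * pi)) * (LINT x|lborel. f x * cis (- (x * \<xi>)))"

definition inv_fourier :: "(real \<Rightarrow> complex) \<Rightarrow> real \<Rightarrow> complex" where
  "inv_fourier g x = complex_of_real (1 / sqrt (2 * pi)) * (LINT \<xi>|lborel. g \<xi> * cis (x * \<xi>))"

(* For \<phi> in the dense class the sum over j has only finitely many nonzero terms. *)
definition S_dense ::
  "real \<Rightarrow> (nat \<Rightarrow> real \<times> real \<Rightarrow> complex) \<Rightarrow> real \<Rightarrow> real \<Rightarrow> real \<Rightarrow> real \<Rightarrow> complex" where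
  "S_dense \<beta> \<phi> u v r \<gamma> = 1 / 4 * (\<Sum>m\<in>{1..4}. \<Sum>\<^sub>\<infinity>j\<in>(UNIV :: int set).
     complex_of_real (r powi j * exp (of_int j * sigma m / 2 * (\<beta> - pi / 2)))
     * cis (2 * pi * of_int j * \<gamma>)
     * inv_fourier (\<lambda>\<xi>. complex_of_real (exp (- (v + eta \<beta> m) * \<xi>))
           * fourier (fourier_coeff (\<phi> m) j) \<xi>
           / complex_of_real (cosh (pi * \<xi>) * cosh ((2 * \<beta> - pi) * (\<xi> - of_int j / 2)))) u)"

definition S1_dense ::
  "real \<Rightarrow> (nat \<Rightarrow> real \<times> real \<Rightarrow> complex) \<Rightarrow> real \<Rightarrow> real \<Rightarrow> complex" where
  "S1_dense \<beta> \<phi> x \<gamma> = 1 / 4 * (\<Sum>m\<in>{1..4}. \<Sum>\<^sub>\<infinity>j\<in>(UNIV :: int set).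
     complex_of_real (exp (of_int j * (1 + sigma m) / 2 * (\<beta> - pi / 2)))
     * cis (2 * pi * of_int j * \<gamma>)
     * inv_fourier (\<lambda>\<xi>. complex_of_real (exp (- (\<beta> + eta \<beta> m) * \<xi>))
           * fourier (fourier_coeff (\<phi> m) j) \<xi>
           / complex_of_real (cosh (pi * \<xi>) * cosh ((2 * \<beta> - pi) * (\<xi> - of_int j / 2)))) x)"

(* Elements of Lebesgue spaces are represented by functions and elements of the Hardy space by
   functions that matter on the domain only. Linearity and boundedness make the operators
   independent of the representatives. *)

definition S_extension ::
  "real \<Rightarrow> real \<Rightarrow> ((nat \<Rightarrow> real \<times> real \<Rightarrow> complex) \<Rightarrow> complex \<times> complex \<Rightarrow> complex) \<Rightarrow> bool" where
  "S_extension p \<beta> S \<longleftrightarrow>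
     (\<forall>\<phi>\<in>bdry_Lp p. S \<phi> \<in> Hp p \<beta>) \<and>
     (\<forall>\<phi>\<in>bdry_Lp p. \<forall>\<psi>\<in>bdry_Lp p. \<forall>a b. \<forall>z\<in>Dprime \<beta>.
        S (\<lambda>l w. a * \<phi> l w + b * \<psi> l w) z = a * S \<phi> z + b * S \<psi> z) \<and>
     (\<exists>C::real. \<forall>\<phi>\<in>bdry_Lp p. Hp_norm p \<beta> (S \<phi>) \<le> ennreal C * bdry_norm p \<phi>) \<and>
     (\<forall>\<phi>\<in>dense_class. \<forall>u v r \<gamma>. r > 0 \<longrightarrow>
        (Complex u v, complex_of_real r * cis (2 * pi * \<gamma>)) \<in> Dprime \<beta> \<longrightarrow>
        S \<phi> (Complex u v, complex_of_real r * cis (2 * pi * \<gamma>)) = S_dense \<beta> \<phi> u v r \<gamma>)"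

definition S1_extension ::
  "real \<Rightarrow> real \<Rightarrow> ((nat \<Rightarrow> real \<times> real \<Rightarrow> complex) \<Rightarrow> real \<times> real \<Rightarrow> complex) \<Rightarrow> bool" where
  "S1_extension p \<beta> S1 \<longleftrightarrow>
     (\<forall>\<phi>\<in>bdry_Lp p. S1 \<phi> \<in> RT_Lp p) \<and>
     (\<forall>\<phi>\<in>bdry_Lp p. \<forall>\<psi>\<in>bdry_Lp p. \<forall>a b. AE w in RT.
        S1 (\<lambda>l w. a * \<phi> l w + b * \<psi> l w) w = a * S1 \<phi> w + b * S1 \<psi> w) \<and>
     (\<exists>C::real. \<forall>\<phi>\<in>bdry_Lp p. RT_norm p (S1 \<phi>) \<le> ennreal C * bdry_norm p \<phi>) \<and>
     (\<forall>\<phi>\<in>dense_class. AE w in RT. S1 \<phi> w = S1_dense \<beta> \<phi> (fst w) (snd w))"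

end

theory Submission
  imports Defs
begin

text \<open>
  Both operators are bounded, so the asserted limit only has to be proved for \<open>\<phi>\<close> in a dense
  class; the error made by replacing \<open>\<phi>\<close> with a nearby \<open>\<psi>\<close> is controlled uniformly in \<open>(t, s)\<close> by the
  Hardy norm of \<open>S (\<phi> - \<psi>)\<close> and by the norm of \<open>S1 (\<phi> - \<psi>)\<close>. Two things remain: that the given class
  is dense in the Lebesgue space of the boundary, and that the limit holds on it.

  On the dense class, the slice of \<open>S \<psi>\<close> is a finite sum of constants times
  \<open>r\<^sup>j exp (2 \<pi> i j \<gamma>)\<close> times an inverse Fourier
  transform of \<open>m(\<xi>) f^(\<xi>)\<close>, with \<open>f\<close> a test function and
  \<open>m(\<xi>) = exp (- a \<xi>) / (cosh (\<pi> \<xi>) cosh (\<kappa> (\<xi> - j / 2)))\<close>, \<open>\<kappa> = 2 \<beta> - \<pi>\<close>, and \<open>S1 \<psi>\<close> is the same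
  expression at the end point of the parameters (\<open>S1_dense_eq_S_dense\<close>). As long as
  \<open>\<bar>a\<bar> \<le> \<pi> + \<kappa> = 2 \<beta>\<close>, which includes the end point, the exponential is dominated by the two
  hyperbolic cosines, so \<open>m\<close> and \<open>m'\<close> are bounded uniformly in \<open>a\<close>. At the end point \<open>m\<close> need not
  decay, but \<open>f^\<close> and its derivative are \<open>O(1 / (1 + \<xi>\<^sup>2))\<close>. One integration by parts in \<open>\<xi>\<close> therefore
  bounds every term by a constant times \<open>1 / (1 + \<bar>u\<bar>)\<close>, uniformly in the parameters
  (\<open>strip_term_decay\<close>). Because \<open>p > 1\<close>, the \<open>p\<close>-th power of this bound is integrable over
  \<open>\<real> \<times> [0, 1)\<close>. Dominated convergence in \<open>\<xi>\<close> gives pointwise convergence (\<open>strip_term_tendsto\<close>), and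
  dominated convergence in \<open>(u, \<gamma>)\<close> turns it into convergence in norm
  (\<open>RT_norm_pow_dense_tendsto\<close>).

  For the density (\<open>dense_class_dense\<close>) it suffices to approximate indicators of rectangles
  \<open>(a, b) \<times> (c, d)\<close>; a Dynkin argument and simple functions do the rest. In the first variable the
  functions \<open>exp (- 1 / (n (x - a) (b - x)))\<close>, extended by \<open>0\<close>, are test functions that increase to
  the indicator of \<open>(a, b)\<close>. In the second variable the trigonometric polynomial
  \<open>2 sin (\<pi> (\<gamma> - c)) sin (\<pi> (d - \<gamma>))\<close> is, for \<open>0 \<le> c \<le> d \<le> 1\<close>, positive on \<open>[0, 1)\<close>
  exactly in \<open>(c, d)\<close>, so the indicator of
  \<open>(c, d)\<close> is a pointwise limit of continuous functions of it, and these are uniform limits of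
  polynomials in it by the Stone--Weierstrass theorem.

  Inequalities are carried out for \<open>RT_norm_pow\<close>, the \<open>p\<close>-th power of the norm, where
  \<open>\<bar>x + y\<bar>\<^sup>p \<le> 2\<^sup>p (\<bar>x\<bar>\<^sup>p + \<bar>y\<bar>\<^sup>p)\<close> takes the place of the triangle inequality.
\<close>

section \<open>Decay of Fourier transforms of test functions\<close>

text \<open>
  The antiderivative \<open>(1 + x) powr (1 - q) / (1 - q)\<close> tends to \<open>0\<close> at infinity because \<open>q > 1\<close>. With
  \<open>q = p\<close> this is the place where \<open>p > 1\<close> enters the argument; with \<open>q = 2\<close> it makes
  \<open>1 / (1 + x\<^sup>2)\<close> integrable.
\<close>

lemma integrable_one_plus_abs_powr:
  fixes q :: real
  assumes "1 < q"
  shows "integrable lborel (\<lambda>x::real. (1 + \<bar>x\<bar>) powr - q)"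
proof -
  let ?f = "\<lambda>x::real. (1 + \<bar>x\<bar>) powr - q"
  let ?F = "\<lambda>x::real. (1 + x) powr (1 - q) / (1 - q)"
  have "((\<lambda>x::real. (1 + x) powr - (q - 1)) \<longlongrightarrow> 0) at_top"
    using assms by (intro tendsto_neg_powr filterlim_tendsto_add_at_top[OF tendsto_const] filterlim_ident) auto
  then have lim: "(?F \<longlongrightarrow> 0) at_top"
    using tendsto_divide[of "\<lambda>x::real. (1 + x) powr - (q - 1)" 0 at_top "\<lambda>_. 1 - q" "1 - q"] assms by auto
  have half: "(\<integral>\<^sup>+x. ennreal (?f x) * indicator {0..} x \<partial>lborel) = ennreal (0 - ?F 0)"
  proof (rule nn_integral_FTC_atLeast[OF _ _ _ lim])
    fix x :: real assume "0 \<le> x"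
    have "(?F has_real_derivative (1 + x) powr - q) (at x)"
      using \<open>0 \<le> x\<close> assms by (auto intro!: derivative_eq_intros)
    then show "DERIV ?F x :> ?f x" using \<open>0 \<le> x\<close> by simp
  qed auto
  have half': "(\<integral>\<^sup>+x. ennreal (?f x) * indicator {..0} x \<partial>lborel)
      = (\<integral>\<^sup>+x. ennreal (?f x) * indicator {0..} x \<partial>lborel)"
    by (subst nn_integral_real_affine[where c="-1" and t=0])
       (auto simp: indicator_def intro!: nn_integral_cong)
  have "(\<integral>\<^sup>+x. ennreal (?f x) \<partial>lborel)
     \<le> (\<integral>\<^sup>+x. ennreal (?f x) * indicator {0..} x + ennreal (?f x) * indicator {..0} x \<partial>lborel)"
    by (intro nn_integral_mono) (auto simp: indicator_def)
  also have "\<dots> = ennreal (0 - ?F 0) + ennreal (0 - ?F 0)"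
    by (subst nn_integral_add) (auto simp only: half half' measurable_lborel1, auto)
  finally have "(\<integral>\<^sup>+x. ennreal (?f x) \<partial>lborel) < \<infinity>"
    by (simp add: order_le_less_trans ennreal_plus[symmetric] del: ennreal_plus)
  then show ?thesis
    by (intro integrableI_bounded) (auto simp: abs_of_nonneg)
qed

lemma integrable_inverse_one_plus_square:
  "integrable lborel (\<lambda>x::real. 1 / (1 + x\<^sup>2))"
proof (rule Bochner_Integration.integrable_bound)
  show "integrable lborel (\<lambda>x::real. 2 * (1 + \<bar>x\<bar>) powr - 2)"
    by (intro integrable_mult_right integrable_one_plus_abs_powr) auto
  show "AE x in lborel. norm (1 / (1 + (x::real)\<^sup>2)) \<le> norm (2 * (1 + \<bar>x\<bar>) powr - 2)"
  proof (rule AE_I2)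
    fix x :: real
    have "(1 + \<bar>x\<bar>)\<^sup>2 \<le> 2 * (1 + x\<^sup>2)"
      using zero_le_power2[of "1 - \<bar>x\<bar>"] by (simp add: power2_eq_square algebra_simps)
    then have "2 / (2 * (1 + x\<^sup>2)) \<le> 2 / (1 + \<bar>x\<bar>)\<^sup>2"
      by (intro divide_left_mono mult_pos_pos) (auto simp: add_pos_nonneg)
    moreover have "2 / (2 * (1 + x\<^sup>2)) = 1 / (1 + x\<^sup>2)"
      by (simp only: divide_divide_eq_left[symmetric])
    moreover have "(1 + \<bar>x\<bar>) powr - 2 = 1 / (1 + \<bar>x\<bar>)\<^sup>2"
      by (simp add: powr_minus powr_numeral divide_inverse)
    ultimately show "norm (1 / (1 + x\<^sup>2)) \<le> norm (2 * (1 + \<bar>x\<bar>) powr - 2)"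
      by simp
  qed
qed auto

text \<open>
  Integration by parts on the whole line, in the form in which it is used below: apply this to a
  product \<open>g(x) cis (u x)\<close> and read the two terms of its derivative separately.
\<close>

lemma integral_derivative_eq_0:
  fixes F f :: "real \<Rightarrow> complex"
  assumes F: "\<And>x. (F has_vector_derivative f x) (at x)"
    and f: "continuous_on UNIV f" "integrable lborel f"
    and lim: "(F \<longlongrightarrow> 0) at_top" "(F \<longlongrightarrow> 0) at_bot"
  shows "(LINT x|lborel. f x) = 0"
proof -
  have "(LBINT x=-\<infinity>..\<infinity>. f x) = 0 - 0"
  proof (rule interval_integral_FTC_integrable)
    show "set_integrable lborel (einterval (- \<infinity>) \<infinity>) f"
      using f(2) by (simp add: set_integrable_def einterval_eq_UNIV)
    show "isCont f x" for x using f(1) by (simp add: continuous_on_eq_continuous_at)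
  qed (use F lim in \<open>auto simp: ereal_tendsto_simps\<close>)
  then show ?thesis
    by (simp add: interval_lebesgue_integral_def set_lebesgue_integral_def einterval_eq_UNIV)
qed

lemma continuous_compact_support_integrable:
  fixes f :: "real \<Rightarrow> 'a::euclidean_space"
  assumes "continuous_on UNIV f" "compact K" "\<And>x. x \<notin> K \<Longrightarrow> f x = 0"
  shows "integrable lborel f"
proof -
  have "integrable lborel (\<lambda>x. indicator K x *\<^sub>R f x)"
    using assms by (intro borel_integrable_compact) (auto intro: continuous_on_subset)
  moreover have "(\<lambda>x. indicator K x *\<^sub>R f x) = f"
    using assms(3) by (auto simp: indicator_def fun_eq_iff)
  ultimately show ?thesis by simp
qed

lemma compact_support_tendsto:
  fixes f :: "real \<Rightarrow> 'a::real_normed_vector"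
  assumes "compact K" "\<And>x. x \<notin> K \<Longrightarrow> f x = 0"
  shows "(f \<longlongrightarrow> 0) at_top" "(f \<longlongrightarrow> 0) at_bot"
proof -
  obtain B where B: "\<And>x. x \<in> K \<Longrightarrow> \<bar>x\<bar> \<le> B"
    using compact_imp_bounded[OF assms(1)] by (auto simp: bounded_iff)
  have "\<forall>\<^sub>F x in at_top. f x = 0"
    using eventually_gt_at_top[of B] by eventually_elim (use B assms(2) in force)
  then show "(f \<longlongrightarrow> 0) at_top" by (rule tendsto_eventually)
  have "\<forall>\<^sub>F x in at_bot. f x = 0"
    using eventually_le_at_bot[of "-B-1"] by eventually_elim (use B assms(2) in force)
  then show "(f \<longlongrightarrow> 0) at_bot" by (rule tendsto_eventually)
qed

lemma derivative_zero_outside_compact: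
  fixes g :: "nat \<Rightarrow> real \<Rightarrow> complex"
  assumes g: "\<And>n x. (g n has_vector_derivative g (Suc n) x) (at x)"
    and K: "compact K" "\<And>x. x \<notin> K \<Longrightarrow> g 0 x = 0" and "x \<notin> K"
  shows "g n x = 0"
  using \<open>x \<notin> K\<close>
proof (induction n arbitrary: x)
  case (Suc n)
  have "((\<lambda>_. 0) has_vector_derivative 0) (at x)" by simp
  then have "(g n has_vector_derivative 0) (at x)"
    by (rule has_vector_derivative_transform_within_open[of _ _ _ "- K"])
       (use Suc K(1) in \<open>auto intro: compact_imp_closed\<close>)
  then show ?case
    using g vector_derivative_unique_at by blast
qed (use K in auto)

text \<open>
  The derivatives of a test function vanish outside the support of the function: the complement of
  the support is open and the function is constantly \<open>0\<close> there.
\<close>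

lemma C0_infinityE:
  assumes "C0_infinity f"
  obtains g K where "g 0 = f" "\<And>n x. (g n has_vector_derivative g (Suc n) x) (at x)"
    "compact K" "\<And>n x. x \<notin> K \<Longrightarrow> g n x = 0" "\<And>n. continuous_on UNIV (g n)"
proof -
  obtain g K where g: "g 0 = f" "\<And>n x. (g n has_vector_derivative g (Suc n) x) (at x)"
    "compact K" "\<And>x. x \<notin> K \<Longrightarrow> f x = 0"
    using assms unfolding C0_infinity_def by metis
  show thesis
  proof (rule that[of g K])
    show "g n x = 0" if "x \<notin> K" for n x
      using derivative_zero_outside_compact[of g K x n] g that by auto
    show "continuous_on UNIV (g n)" for n
      using g(2) by (auto intro!: continuous_at_imp_continuous_on has_vector_derivative_continuous)
  qed (use g in auto)
qed

text \<open>
  Multiplication by the variable is what differentiation of the Fourier transform amounts to; the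
  \<open>n\<close>-th derivative of \<open>x g(x)\<close> is \<open>x g\<^sub>n(x) + n g\<^sub>n\<^sub>-\<^sub>1(x)\<close>, where \<open>g\<^sub>n\<close> is the \<open>n\<close>-th derivative of \<open>g\<close>.
\<close>

lemma C0_infinity_mult_ident:
  assumes "C0_infinity f"
  shows "C0_infinity (\<lambda>x. c * complex_of_real x * f x)"
proof -
  obtain g K where g: "g 0 = f" "\<And>n x. (g n has_vector_derivative g (Suc n) x) (at x)"
    "compact K" "\<And>n x. x \<notin> K \<Longrightarrow> g n x = 0" "\<And>n. continuous_on UNIV (g n)"
    using C0_infinityE[OF assms] by metis
  define h where "h n x = c * (of_real x * g n x + of_nat n * g (n - 1) x)" for n and x :: real
  have "(h n has_vector_derivative h (Suc n) x) (at x)" for n x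
  proof -
    have x: "(complex_of_real has_vector_derivative 1) (at x)"
      using has_vector_derivative_of_real[OF DERIV_ident] by simp
    have "((\<lambda>x. of_real x * g n x) has_vector_derivative (of_real x * g (Suc n) x + 1 * g n x)) (at x)"
      by (intro has_vector_derivative_mult x g)
    moreover have "((\<lambda>x. of_nat n * g (n - 1) x) has_vector_derivative of_nat n * g n x) (at x)"
    proof (cases n)
      case (Suc m)
      then show ?thesis using has_vector_derivative_mult_right[OF g(2)[of m x], of "of_nat n"] by simp
    qed auto
    ultimately have "((\<lambda>x. c * (of_real x * g n x + of_nat n * g (n - 1) x)) has_vector_derivative
       c * ((of_real x * g (Suc n) x + 1 * g n x) + of_nat n * g n x)) (at x)"
      by (rule has_vector_derivative_mult_right[OF has_vector_derivative_add])
    then show ?thesis unfolding h_def by (simp add: algebra_simps)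
  qed
  moreover have "h 0 = (\<lambda>x. c * of_real x * f x)" unfolding h_def g(1) by (simp add: fun_eq_iff)
  moreover have "\<forall>x. x \<notin> K \<longrightarrow> c * complex_of_real x * f x = 0" using g(1,4) by force
  ultimately show ?thesis unfolding C0_infinity_def using g(3) by blast
qed

lemma has_vector_derivative_cis_linear:
  "((\<lambda>x. cis (u * x)) has_vector_derivative \<i> * of_real u * cis (u * x)) (at x)"
proof -
  have "((\<lambda>x. exp (\<i> * of_real u * of_real x)) has_vector_derivative
      \<i> * of_real u * exp (\<i> * of_real u * of_real x)) (at x)"
    by (rule has_vector_derivative_real_field) (auto intro!: derivative_eq_intros)
  then show ?thesis by (simp add: cis_conv_exp mult.assoc)
qed

lemma fourier_derivative:
  assumes g: "\<And>x. (g has_vector_derivative g' x) (at x)"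
    and cont: "continuous_on UNIV g'" and K: "compact K" "\<And>x. x \<notin> K \<Longrightarrow> g x = 0" "\<And>x. x \<notin> K \<Longrightarrow> g' x = 0"
  shows "fourier g' \<xi> = \<i> * of_real \<xi> * fourier g \<xi>"
proof -
  have contg: "continuous_on UNIV g"
    using g by (auto intro!: continuous_at_imp_continuous_on has_vector_derivative_continuous)
  have cis: "continuous_on UNIV (\<lambda>x. cis (- (x * \<xi>)))"
    by (intro continuous_intros)
  have int: "integrable lborel (\<lambda>x. g x * cis (- (x * \<xi>)))" "integrable lborel (\<lambda>x. g' x * cis (- (x * \<xi>)))"
    by (rule continuous_compact_support_integrable[OF continuous_on_mult K(1)]; use K cont contg cis in auto)+
  let ?f = "\<lambda>x. g x * (- \<i> * of_real \<xi> * cis (- (x * \<xi>))) + g' x * cis (- (x * \<xi>))"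
  have "(LINT x|lborel. ?f x) = 0"
  proof (rule integral_derivative_eq_0)
    show "((\<lambda>x. g x * cis (- (x * \<xi>))) has_vector_derivative ?f x) (at x)" for x
      using has_vector_derivative_mult[OF g has_vector_derivative_cis_linear[of "-\<xi>" x]]
      by (simp add: mult.commute)
    show "continuous_on UNIV ?f"
      by (intro continuous_intros cont contg)
    show "integrable lborel ?f"
      using Bochner_Integration.integrable_add[OF integrable_mult_right[OF int(1), of "- \<i> * of_real \<xi>"] int(2)]
      by (simp add: algebra_simps)
  qed (rule compact_support_tendsto[OF K(1)], use K in auto)+
  moreover have "(LINT x|lborel. ?f x) = (LINT x|lborel. (- \<i> * of_real \<xi>) * (g x * cis (- (x * \<xi>))) + g' x * cis (- (x * \<xi>)))"
    by (intro Bochner_Integration.integral_cong) (auto simp: algebra_simps)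
  moreover have "\<dots> = - \<i> * of_real \<xi> * (LINT x|lborel. g x * cis (- (x * \<xi>))) + (LINT x|lborel. g' x * cis (- (x * \<xi>)))"
    by (subst Bochner_Integration.integral_add) (use int in \<open>auto intro!: integrable_mult_right\<close>)
  ultimately show ?thesis unfolding fourier_def by (simp add: algebra_simps)
qed

lemma fourier_norm_le:
  assumes "integrable lborel f"
  shows "cmod (fourier f \<xi>) \<le> (1 / sqrt (2 * pi)) * (LINT x|lborel. cmod (f x))"
proof -
  have "cmod (LINT x|lborel. f x * cis (- (x * \<xi>))) \<le> (LINT x|lborel. cmod (f x * cis (- (x * \<xi>))))"
    by (rule integral_norm_bound)
  then show ?thesis unfolding fourier_def
    by (simp add: norm_mult norm_divide divide_right_mono)
qed

text \<open>
  Two derivatives on \<open>f\<close> cost a factor \<open>\<xi>\<^sup>2\<close>, so \<open>(1 + \<xi>\<^sup>2) f^(\<xi>)\<close> is bounded by the integrals of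
  \<open>\<bar>f\<bar>\<close> and \<open>\<bar>f''\<bar>\<close>.
\<close>

lemma fourier_C0_infinity_decay:
  assumes "C0_infinity f"
  shows "\<exists>A. \<forall>\<xi>. cmod (fourier f \<xi>) \<le> A / (1 + \<xi>\<^sup>2)"
proof -
  obtain g K where g: "g 0 = f" "\<And>n x. (g n has_vector_derivative g (Suc n) x) (at x)"
    "compact K" "\<And>n x. x \<notin> K \<Longrightarrow> g n x = 0" "\<And>n. continuous_on UNIV (g n)"
    using C0_infinityE[OF assms] by metis
  have int: "integrable lborel (g n)" for n
    using g by (intro continuous_compact_support_integrable[of _ K]) auto
  define B where "B n = (1 / sqrt (2 * pi)) * (LINT x|lborel. cmod (g n x))" for n
  have "cmod (fourier f \<xi>) \<le> (B 0 + B 2) / (1 + \<xi>\<^sup>2)" for \<xi>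
  proof -
    have step: "fourier (g (Suc n)) \<xi> = \<i> * of_real \<xi> * fourier (g n) \<xi>" for n
      using g by (intro fourier_derivative[of _ _ K]) auto
    have "fourier (g 2) \<xi> = - of_real (\<xi>\<^sup>2) * fourier f \<xi>"
      using step[of 1] step[of 0] g(1) by (simp add: numeral_2_eq_2 power2_eq_square algebra_simps)
    then have "\<xi>\<^sup>2 * cmod (fourier f \<xi>) = cmod (fourier (g 2) \<xi>)"
      by (simp add: norm_mult norm_power)
    also have "\<dots> \<le> B 2" unfolding B_def by (rule fourier_norm_le[OF int])
    finally have "\<xi>\<^sup>2 * cmod (fourier f \<xi>) \<le> B 2" .
    moreover have "cmod (fourier f \<xi>) \<le> B 0"
      unfolding B_def g(1)[symmetric] by (rule fourier_norm_le[OF int])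
    ultimately have "(1 + \<xi>\<^sup>2) * cmod (fourier f \<xi>) \<le> B 0 + B 2" by (simp add: algebra_simps)
    then show ?thesis by (simp add: field_simps add_pos_nonneg)
  qed
  then show ?thesis by blast
qed

text \<open>
  Since \<open>f\<close> has compact support, the Fourier integral runs over a fixed bounded interval, on which
  differentiation under the integral sign needs only continuity.
\<close>

lemma fourier_has_vector_derivative:
  assumes "C0_infinity f"
  shows "(fourier f has_vector_derivative fourier (\<lambda>x. - \<i> * of_real x * f x) \<xi>) (at \<xi>)"
proof -
  obtain g K where g: "g 0 = f" "\<And>n x. (g n has_vector_derivative g (Suc n) x) (at x)"
    "compact K" "\<And>n x. x \<notin> K \<Longrightarrow> g n x = 0" "\<And>n. continuous_on UNIV (g n)"
    using C0_infinityE[OF assms] by metis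
  have contf: "continuous_on UNIV f" and f0: "x \<notin> K \<Longrightarrow> f x = 0" for x
    using g(1,4,5) by auto
  obtain a b where K: "K \<subseteq> cbox a b"
    using bounded_subset_cbox_symmetric[OF compact_imp_bounded[OF g(3)]] by blast
  have eq: "(LINT x|lborel. h x) = integral (cbox a b) h"
    if "continuous_on UNIV h" "\<And>x. x \<notin> K \<Longrightarrow> h x = 0" for h :: "real \<Rightarrow> complex"
  proof -
    have "integrable lborel h"
      using that g(3) by (intro continuous_compact_support_integrable[of _ K])
    then have "(LINT x|lborel. h x) = integral UNIV h"
      by (simp add: integral_lborel)
    also have "integral UNIV h = integral UNIV (\<lambda>x. if x \<in> cbox a b then h x else 0)"
      using that(2) K by (intro arg_cong[of _ _ "integral UNIV"]) fastforce
    also have "\<dots> = integral (cbox a b) h"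
      by (rule integral_restrict_UNIV)
    finally show ?thesis .
  qed
  have 1: "(LINT x|lborel. f x * cis (- (x * \<xi>))) = integral (cbox a b) (\<lambda>x. f x * cis (- (x * \<xi>)))" for \<xi>
    using f0 by (intro eq continuous_intros contf) auto
  have 2: "(LINT x|lborel. - \<i> * of_real x * f x * cis (- (x * \<xi>)))
     = integral (cbox a b) (\<lambda>x. - \<i> * of_real x * f x * cis (- (x * \<xi>)))" for \<xi>
    using f0 by (intro eq continuous_intros contf) auto
  have "((\<lambda>\<xi>. integral (cbox a b) (\<lambda>x. f x * cis (- (x * \<xi>)))) has_vector_derivative
       integral (cbox a b) (\<lambda>x. - \<i> * of_real x * f x * cis (- (x * \<xi>)))) (at \<xi> within UNIV)"
  proof (rule leibniz_rule_vector_derivative)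
    show "((\<lambda>\<xi>. f x * cis (- (x * \<xi>))) has_vector_derivative - \<i> * of_real x * f x * cis (- (x * \<xi>)))
        (at \<xi> within UNIV)" for x \<xi>
      using has_vector_derivative_mult_right[OF has_vector_derivative_cis_linear[of "-x" \<xi>], of "f x"]
      by (simp add: algebra_simps)
    show "(\<lambda>x. f x * cis (- (x * \<xi>))) integrable_on cbox a b" for \<xi>
      by (intro integrable_continuous continuous_intros continuous_on_subset[OF contf]) auto
    show "continuous_on (UNIV \<times> cbox a b) (\<lambda>(\<xi>, x). - \<i> * of_real x * f x * cis (- (x * \<xi>)))"
      unfolding split_beta
      by (intro continuous_intros continuous_on_compose2[OF contf]) auto
  qed auto
  then have "((\<lambda>\<xi>. of_real (1 / sqrt (2 * pi)) * integral (cbox a b) (\<lambda>x. f x * cis (- (x * \<xi>))))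
      has_vector_derivative of_real (1 / sqrt (2 * pi)) *
      integral (cbox a b) (\<lambda>x. - \<i> * of_real x * f x * cis (- (x * \<xi>)))) (at \<xi>)"
    by (intro has_vector_derivative_mult_right) simp
  then show ?thesis unfolding fourier_def 1 2 .
qed

section \<open>The multiplier and its inverse Fourier transform\<close>

text \<open>
  In the symbol of \<open>S_dense\<close>, \<open>\<kappa>\<close> is \<open>2 \<beta> - \<pi>\<close>, \<open>b\<close> is \<open>j / 2\<close> and \<open>a\<close> is \<open>v + eta \<beta> m\<close>.
\<close>

definition strip_multiplier :: "real \<Rightarrow> real \<Rightarrow> real \<Rightarrow> real \<Rightarrow> real" where
  "strip_multiplier \<kappa> b a \<xi> = exp (- a * \<xi>) / (cosh (pi * \<xi>) * cosh (\<kappa> * (\<xi> - b)))"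

text \<open>
  From \<open>exp \<bar>y\<bar> \<le> 2 cosh y\<close>, the multiplier is at most
  \<open>4 exp (\<bar>a\<bar> \<bar>\<xi>\<bar> - \<pi> \<bar>\<xi>\<bar> - \<kappa> \<bar>\<xi> - b\<bar>)\<close>, and the exponent is at most \<open>\<kappa> \<bar>b\<bar>\<close> up to and including the extreme
  value \<open>\<bar>a\<bar> = \<pi> + \<kappa>\<close>.
\<close>

lemma strip_multiplier_bound:
  assumes "0 \<le> \<kappa>" "\<bar>a\<bar> \<le> pi + \<kappa>"
  shows "\<bar>strip_multiplier \<kappa> b a \<xi>\<bar> \<le> 4 * exp (\<kappa> * \<bar>b\<bar>)"
proof -
  have cosh_ge: "exp \<bar>y\<bar> \<le> 2 * cosh y" for y :: real
    by (cases "y \<ge> 0") (auto simp: cosh_def)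
  have "- a * \<xi> \<le> \<bar>a\<bar> * \<bar>\<xi>\<bar>"
    by (metis abs_ge_self abs_minus_cancel abs_mult)
  also have "\<dots> \<le> (pi + \<kappa>) * \<bar>\<xi>\<bar>" using assms by (intro mult_right_mono) auto
  finally have "- a * \<xi> \<le> (pi + \<kappa>) * \<bar>\<xi>\<bar>" .
  moreover have "\<kappa> * \<bar>\<xi>\<bar> \<le> \<kappa> * (\<bar>\<xi> - b\<bar> + \<bar>b\<bar>)"
    using assms by (intro mult_left_mono) auto
  ultimately have le: "- a * \<xi> \<le> (pi + \<kappa>) * \<bar>\<xi>\<bar>" "\<kappa> * \<bar>\<xi>\<bar> \<le> \<kappa> * (\<bar>\<xi> - b\<bar> + \<bar>b\<bar>)"
    by auto
  have "- a * \<xi> \<le> \<bar>pi * \<xi>\<bar> + \<bar>\<kappa> * (\<xi> - b)\<bar> + \<kappa> * \<bar>b\<bar>"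
  proof -
    have "\<bar>pi * \<xi>\<bar> = pi * \<bar>\<xi>\<bar>" "\<bar>\<kappa> * (\<xi> - b)\<bar> = \<kappa> * \<bar>\<xi> - b\<bar>"
      using assms by (simp_all add: abs_mult)
    then show ?thesis
      using le by (simp only: distrib_left distrib_right)
  qed
  then have "exp (- a * \<xi>) \<le> exp \<bar>pi * \<xi>\<bar> * exp \<bar>\<kappa> * (\<xi> - b)\<bar> * exp (\<kappa> * \<bar>b\<bar>)"
    by (simp add: exp_add[symmetric])
  also have "\<dots> \<le> (2 * cosh (pi * \<xi>)) * (2 * cosh (\<kappa> * (\<xi> - b))) * exp (\<kappa> * \<bar>b\<bar>)"
    by (intro mult_mono cosh_ge) auto
  finally show ?thesis
    by (simp add: strip_multiplier_def field_simps)
qed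

definition strip_multiplier_deriv :: "real \<Rightarrow> real \<Rightarrow> real \<Rightarrow> real \<Rightarrow> real" where
  "strip_multiplier_deriv \<kappa> b a \<xi> =
     strip_multiplier \<kappa> b a \<xi> * (- a - pi * tanh (pi * \<xi>) - \<kappa> * tanh (\<kappa> * (\<xi> - b)))"

lemma strip_multiplier_has_derivative:
  "(strip_multiplier \<kappa> b a has_real_derivative strip_multiplier_deriv \<kappa> b a \<xi>) (at \<xi>)"
proof -
  let ?c = "cosh (pi * \<xi>)" and ?d = "cosh (\<kappa> * (\<xi> - b))"
  have pos: "?c > 0" "?d > 0" by auto
  have "((\<lambda>\<xi>. exp (- a * \<xi>) / (cosh (pi * \<xi>) * cosh (\<kappa> * (\<xi> - b)))) has_real_derivative
     ((exp (- a * \<xi>) * (- a)) * (?c * ?d) - exp (- a * \<xi>) *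
       ((sinh (pi * \<xi>) * pi) * ?d + ?c * (sinh (\<kappa> * (\<xi> - b)) * \<kappa>))) / ((?c * ?d) * (?c * ?d))) (at \<xi>)"
    using pos by (auto intro!: derivative_eq_intros simp: mult_ac)
  moreover have "((exp (- a * \<xi>) * (- a)) * (?c * ?d) - exp (- a * \<xi>) *
       ((sinh (pi * \<xi>) * pi) * ?d + ?c * (sinh (\<kappa> * (\<xi> - b)) * \<kappa>))) / ((?c * ?d) * (?c * ?d))
     = strip_multiplier_deriv \<kappa> b a \<xi>"
    using pos unfolding strip_multiplier_deriv_def strip_multiplier_def tanh_def
    by (simp add: divide_simps) (simp add: algebra_simps)
  ultimately show ?thesis unfolding strip_multiplier_def by simp
qed

text \<open>
  The logarithmic derivative of the multiplier is a constant plus two bounded hyperbolic tangents.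
\<close>

lemma strip_multiplier_deriv_bound:
  assumes "0 \<le> \<kappa>" "\<bar>a\<bar> \<le> pi + \<kappa>"
  shows "\<bar>strip_multiplier_deriv \<kappa> b a \<xi>\<bar> \<le> 4 * exp (\<kappa> * \<bar>b\<bar>) * (2 * (pi + \<kappa>))"
proof -
  have tanh: "\<bar>tanh y\<bar> \<le> 1" for y :: real
    using tanh_real_bounds[of y] by (auto simp: abs_le_iff)
  have "\<bar>pi * tanh (pi * \<xi>)\<bar> \<le> pi * 1" "\<bar>\<kappa> * tanh (\<kappa> * (\<xi> - b))\<bar> \<le> \<kappa> * 1"
    unfolding abs_mult using assms(1) tanh by (intro mult_mono; simp)+
  moreover have "\<bar>- a - x - y\<bar> \<le> 2 * (pi + \<kappa>)" if "\<bar>x\<bar> \<le> pi * 1" "\<bar>y\<bar> \<le> \<kappa> * 1" for x y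
    using assms that by (auto simp: abs_le_iff)
  ultimately have "\<bar>- a - pi * tanh (pi * \<xi>) - \<kappa> * tanh (\<kappa> * (\<xi> - b))\<bar> \<le> 2 * (pi + \<kappa>)"
    by blast
  then show ?thesis
    unfolding strip_multiplier_deriv_def abs_mult
    using strip_multiplier_bound[OF assms, of b \<xi>] assms by (intro mult_mono) auto
qed

lemma continuous_strip_multiplier:
  "continuous_on UNIV (strip_multiplier \<kappa> b a)" "continuous_on UNIV (strip_multiplier_deriv \<kappa> b a)"
proof -
  have ne: "cosh x \<noteq> 0" for x :: real using cosh_real_pos[of x] by linarith
  show 1: "continuous_on UNIV (strip_multiplier \<kappa> b a)"
    unfolding strip_multiplier_def by (intro continuous_intros) (auto simp: ne)
  show "continuous_on UNIV (strip_multiplier_deriv \<kappa> b a)"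
    unfolding strip_multiplier_deriv_def
    by (intro continuous_intros continuous_on_compose2[OF 1]) (auto simp: ne)
qed

text \<open>
  The integral of \<open>g\<close> against \<open>cis (u \<xi>)\<close> is bounded trivially, and \<open>u\<close> times it is bounded by the
  integral of \<open>\<bar>g'\<bar>\<close> after one integration by parts.
\<close>

lemma inv_fourier_decay:
  fixes g :: "real \<Rightarrow> complex"
  assumes g: "\<And>\<xi>. (g has_vector_derivative g' \<xi>) (at \<xi>)" and cont: "continuous_on UNIV g'"
    and bnd: "\<And>\<xi>. cmod (g \<xi>) \<le> K / (1 + \<xi>\<^sup>2)" "\<And>\<xi>. cmod (g' \<xi>) \<le> K / (1 + \<xi>\<^sup>2)"
  shows "(1 + \<bar>u\<bar>) * cmod (inv_fourier g u) \<le> 2 * K * (LINT \<xi>|lborel. 1 / (1 + \<xi>\<^sup>2))"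
proof -
  let ?I = "LINT \<xi>|lborel. 1 / (1 + \<xi>\<^sup>2)"
  have contg: "continuous_on UNIV g"
    using g by (auto intro!: continuous_at_imp_continuous_on has_vector_derivative_continuous)
  have intK: "integrable lborel (\<lambda>\<xi>. K / (1 + \<xi>\<^sup>2))"
    using integrable_mult_right[OF integrable_inverse_one_plus_square, of K] by simp
  have K: "0 \<le> K" using order_trans[OF norm_ge_zero bnd(1)[of 0]] by simp
  have I: "cmod (LINT \<xi>|lborel. h \<xi> * cis (u * \<xi>)) \<le> K * ?I \<and> integrable lborel (\<lambda>\<xi>. h \<xi> * cis (u * \<xi>))"
    if h: "continuous_on UNIV h" "\<And>\<xi>. cmod (h \<xi>) \<le> K / (1 + \<xi>\<^sup>2)" for h
  proof
    have "continuous_on UNIV (\<lambda>\<xi>. h \<xi> * cis (u * \<xi>))"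
      by (intro continuous_intros h(1))
    then have "(\<lambda>\<xi>. h \<xi> * cis (u * \<xi>)) \<in> borel_measurable borel"
      by (rule borel_measurable_continuous_onI)
    then show int: "integrable lborel (\<lambda>\<xi>. h \<xi> * cis (u * \<xi>))"
      using h(2) K by (intro Bochner_Integration.integrable_bound[OF intK]) (auto simp: norm_mult)
    have "cmod (LINT \<xi>|lborel. h \<xi> * cis (u * \<xi>)) \<le> (LINT \<xi>|lborel. K / (1 + \<xi>\<^sup>2))"
      using h(2) int by (intro Bochner_Integration.integral_norm_bound_integral[OF _ intK]) (auto simp: norm_mult)
    then show "cmod (LINT \<xi>|lborel. h \<xi> * cis (u * \<xi>)) \<le> K * ?I"
      using integral_mult_right_zero[of lborel K "\<lambda>\<xi>. 1 / (1 + \<xi>\<^sup>2)"] by simp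
  qed
  have tend: "((\<lambda>\<xi>. K / (1 + \<xi>\<^sup>2)) \<longlongrightarrow> 0) F" if "filterlim (\<lambda>\<xi>::real. \<xi>\<^sup>2) at_top F" for F
    by (intro real_tendsto_divide_at_top[OF tendsto_const] filterlim_tendsto_add_at_top[OF tendsto_const] that)
  have sq: "filterlim (\<lambda>\<xi>::real. \<xi>\<^sup>2) at_top at_top" "filterlim (\<lambda>\<xi>::real. \<xi>\<^sup>2) at_top at_bot"
    by (intro filterlim_pow_at_top filterlim_pow_at_bot_even filterlim_ident; simp)+
  have lim: "((\<lambda>\<xi>. g \<xi> * cis (u * \<xi>)) \<longlongrightarrow> 0) F" if "filterlim (\<lambda>\<xi>::real. \<xi>\<^sup>2) at_top F" for F
    by (rule Lim_null_comparison[OF _ tend[OF that]]) (use bnd(1) in \<open>auto simp: norm_mult\<close>)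
  let ?f = "\<lambda>\<xi>. g \<xi> * (\<i> * of_real u * cis (u * \<xi>)) + g' \<xi> * cis (u * \<xi>)"
  have "(LINT \<xi>|lborel. ?f \<xi>) = 0"
  proof (rule integral_derivative_eq_0)
    show "((\<lambda>\<xi>. g \<xi> * cis (u * \<xi>)) has_vector_derivative ?f \<xi>) (at \<xi>)" for \<xi>
      by (rule has_vector_derivative_mult[OF g has_vector_derivative_cis_linear])
    show "continuous_on UNIV ?f"
      by (intro continuous_intros cont contg)
    show "integrable lborel ?f"
      using Bochner_Integration.integrable_add[OF integrable_mult_right[of "\<i> * of_real u", OF conjunct2[OF I[OF contg bnd(1)]]]
          conjunct2[OF I[OF cont bnd(2)]]]
      by (simp add: algebra_simps)
  qed (intro lim sq)+
  moreover have "(LINT \<xi>|lborel. ?f \<xi>) = (LINT \<xi>|lborel. (\<i> * of_real u) * (g \<xi> * cis (u * \<xi>)) + g' \<xi> * cis (u * \<xi>))"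
    by (intro Bochner_Integration.integral_cong) (auto simp: algebra_simps)
  moreover have "\<dots> = \<i> * of_real u * (LINT \<xi>|lborel. g \<xi> * cis (u * \<xi>)) + (LINT \<xi>|lborel. g' \<xi> * cis (u * \<xi>))"
    using I[OF contg bnd(1)] I[OF cont bnd(2)]
    by (subst Bochner_Integration.integral_add) auto
  ultimately have "\<i> * of_real u * (LINT \<xi>|lborel. g \<xi> * cis (u * \<xi>)) = - (LINT \<xi>|lborel. g' \<xi> * cis (u * \<xi>))"
    by (simp add: eq_neg_iff_add_eq_0)
  from arg_cong[OF this, of cmod] have "\<bar>u\<bar> * cmod (LINT \<xi>|lborel. g \<xi> * cis (u * \<xi>)) \<le> K * ?I"
    using I[OF cont bnd(2)] by (simp add: norm_mult)
  then have *: "(1 + \<bar>u\<bar>) * cmod (LINT \<xi>|lborel. g \<xi> * cis (u * \<xi>)) \<le> 2 * K * ?I"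
    using I[OF contg bnd(1)] by (simp add: algebra_simps)
  have "sqrt 1 \<le> sqrt (2 * pi)"
    using pi_ge_two by (intro real_sqrt_le_mono) linarith
  then have "1 / sqrt (2 * pi) \<le> 1" by simp
  then have "cmod (inv_fourier g u) \<le> cmod (LINT \<xi>|lborel. g \<xi> * cis (u * \<xi>))"
    unfolding inv_fourier_def norm_mult norm_of_real
    by (intro mult_left_le_one_le) auto
  then show ?thesis
    using * mult_left_mono[of "cmod (inv_fourier g u)" _ "1 + \<bar>u\<bar>"] by fastforce
qed

definition strip_term :: "real \<Rightarrow> real \<Rightarrow> (real \<Rightarrow> complex) \<Rightarrow> real \<Rightarrow> real \<Rightarrow> complex" where
  "strip_term \<kappa> b f a u = inv_fourier (\<lambda>\<xi>. of_real (strip_multiplier \<kappa> b a \<xi>) * fourier f \<xi>) u"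

text \<open>
  The constant does not depend on \<open>a\<close>, because neither the bound for the multiplier nor the one for
  its derivative does.
\<close>

lemma strip_term_decay:
  assumes f: "C0_infinity f" and "0 \<le> \<kappa>"
  shows "\<exists>C. \<forall>a u. \<bar>a\<bar> \<le> pi + \<kappa> \<longrightarrow> (1 + \<bar>u\<bar>) * cmod (strip_term \<kappa> b f a u) \<le> C"
proof -
  define f' where "f' x = - \<i> * of_real x * f x" for x :: real
  have f': "C0_infinity f'" unfolding f'_def by (rule C0_infinity_mult_ident[OF f])
  have deriv: "(fourier f has_vector_derivative fourier f' \<xi>) (at \<xi>)" for \<xi>
    unfolding f'_def by (rule fourier_has_vector_derivative[OF f])
  have cont: "continuous_on UNIV (fourier h)" if "C0_infinity h" for h
    using fourier_has_vector_derivative[OF that]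
    by (auto intro!: continuous_at_imp_continuous_on has_vector_derivative_continuous)
  obtain A where A: "\<And>\<xi>. cmod (fourier f \<xi>) \<le> A / (1 + \<xi>\<^sup>2)"
    using fourier_C0_infinity_decay[OF f] by blast
  obtain A' where A': "\<And>\<xi>. cmod (fourier f' \<xi>) \<le> A' / (1 + \<xi>\<^sup>2)"
    using fourier_C0_infinity_decay[OF f'] by blast
  have A0: "0 \<le> A" "0 \<le> A'"
    using order_trans[OF norm_ge_zero A[of 0]] order_trans[OF norm_ge_zero A'[of 0]] by auto
  define M where "M = 4 * exp (\<kappa> * \<bar>b\<bar>)"
  define K where "K = M * (2 * (pi + \<kappa>)) * A + M * A + M * A'"
  have M: "0 \<le> M" unfolding M_def by simp
  have "(1 + \<bar>u\<bar>) * cmod (strip_term \<kappa> b f a u) \<le> 2 * K * (LINT \<xi>|lborel. 1 / (1 + \<xi>\<^sup>2))"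
    if a: "\<bar>a\<bar> \<le> pi + \<kappa>" for a u
    unfolding strip_term_def
  proof (rule inv_fourier_decay)
    let ?m = "strip_multiplier \<kappa> b a" and ?m' = "strip_multiplier_deriv \<kappa> b a"
    let ?g' = "\<lambda>\<xi>. of_real (?m \<xi>) * fourier f' \<xi> + of_real (?m' \<xi>) * fourier f \<xi>"
    have m: "\<bar>?m \<xi>\<bar> \<le> M" "\<bar>?m' \<xi>\<bar> \<le> M * (2 * (pi + \<kappa>))" for \<xi>
      unfolding M_def by (intro strip_multiplier_bound strip_multiplier_deriv_bound assms a)+
    show "((\<lambda>\<xi>. of_real (?m \<xi>) * fourier f \<xi>) has_vector_derivative ?g' \<xi>) (at \<xi>)" for \<xi>
      by (rule has_vector_derivative_mult[OF has_vector_derivative_of_real[OF strip_multiplier_has_derivative] deriv])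
    show "continuous_on UNIV ?g'"
      by (intro continuous_intros cont f f' continuous_strip_multiplier)
    fix \<xi> :: real
    have "cmod (of_real (?m \<xi>) * fourier f \<xi>) \<le> M * (A / (1 + \<xi>\<^sup>2))"
      unfolding norm_mult norm_of_real using m A by (intro mult_mono) (auto simp: M)
    also have "\<dots> \<le> K / (1 + \<xi>\<^sup>2)"
      unfolding K_def using M A0 assms by (auto intro!: divide_right_mono)
    finally show "cmod (of_real (?m \<xi>) * fourier f \<xi>) \<le> K / (1 + \<xi>\<^sup>2)" .
    have "cmod (?g' \<xi>) \<le> cmod (of_real (?m \<xi>) * fourier f' \<xi>) + cmod (of_real (?m' \<xi>) * fourier f \<xi>)"
      by (rule norm_triangle_ineq)
    also have "\<dots> \<le> M * (A' / (1 + \<xi>\<^sup>2)) + M * (2 * (pi + \<kappa>)) * (A / (1 + \<xi>\<^sup>2))"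
      unfolding norm_mult norm_of_real using m A A' assms by (intro mult_mono add_mono) (auto simp: M)
    also have "\<dots> \<le> K / (1 + \<xi>\<^sup>2)"
      unfolding K_def using M A0 by (simp add: add_divide_distrib)
    finally show "cmod (?g' \<xi>) \<le> K / (1 + \<xi>\<^sup>2)" .
  qed
  then show ?thesis by blast
qed

lemma strip_term_tendsto:
  assumes f: "C0_infinity f" and "0 \<le> \<kappa>"
    and a: "\<And>n. \<bar>a n\<bar> \<le> pi + \<kappa>" "a \<longlonglongrightarrow> a0"
  shows "(\<lambda>n. strip_term \<kappa> b f (a n) u) \<longlonglongrightarrow> strip_term \<kappa> b f a0 u"
proof -
  obtain A where A: "\<And>\<xi>. cmod (fourier f \<xi>) \<le> A / (1 + \<xi>\<^sup>2)"
    using fourier_C0_infinity_decay[OF f] by blast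
  have cont: "continuous_on UNIV (fourier f)"
    using fourier_has_vector_derivative[OF f]
    by (auto intro!: continuous_at_imp_continuous_on has_vector_derivative_continuous)
  let ?h = "\<lambda>a \<xi>. of_real (strip_multiplier \<kappa> b a \<xi>) * fourier f \<xi> * cis (u * \<xi>)"
  have meas: "?h a \<in> borel_measurable lborel" for a
  proof -
    have "continuous_on UNIV (?h a)"
      by (intro continuous_intros cont continuous_strip_multiplier)
    then show ?thesis by (simp add: borel_measurable_continuous_onI)
  qed
  have "(\<lambda>n. LINT \<xi>|lborel. ?h (a n) \<xi>) \<longlonglongrightarrow> (LINT \<xi>|lborel. ?h a0 \<xi>)"
  proof (rule integral_dominated_convergence)
    show "integrable lborel (\<lambda>\<xi>::real. 4 * exp (\<kappa> * \<bar>b\<bar>) * A * (1 / (1 + \<xi>\<^sup>2)))"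
      by (intro integrable_mult_right integrable_inverse_one_plus_square)
    show "AE \<xi> in lborel. (\<lambda>n. ?h (a n) \<xi>) \<longlonglongrightarrow> ?h a0 \<xi>"
      unfolding strip_multiplier_def by (intro AE_I2 tendsto_intros a) (simp add: less_imp_neq[OF cosh_real_pos, symmetric])
    show "AE \<xi> in lborel. cmod (?h (a n) \<xi>) \<le> 4 * exp (\<kappa> * \<bar>b\<bar>) * A * (1 / (1 + \<xi>\<^sup>2))" for n
    proof (rule AE_I2)
      fix \<xi> :: real
      have "cmod (?h (a n) \<xi>) \<le> 4 * exp (\<kappa> * \<bar>b\<bar>) * (A / (1 + \<xi>\<^sup>2))"
        unfolding norm_mult norm_of_real norm_cis mult_1_right
        by (intro mult_mono A strip_multiplier_bound assms) auto
      then show "cmod (?h (a n) \<xi>) \<le> 4 * exp (\<kappa> * \<bar>b\<bar>) * A * (1 / (1 + \<xi>\<^sup>2))" by simp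
    qed
  qed (rule meas)+
  then show ?thesis
    unfolding strip_term_def inv_fourier_def by (intro tendsto_intros) (simp add: mult_ac)
qed

section \<open>Smooth bump functions\<close>

text \<open>
  The functions \<open>P / q\<^sup>k exp (- 1 / q)\<close> on \<open>{q > 0}\<close>, extended by \<open>0\<close>. This class is closed under
  differentiation, which makes \<open>exp (- 1 / q)\<close> smooth for every polynomial \<open>q\<close>.
\<close>

definition flat :: "real poly \<Rightarrow> real poly \<Rightarrow> nat \<Rightarrow> real \<Rightarrow> real" where
  "flat q P k x = (if 0 < poly q x then poly P x / poly q x ^ k * exp (- 1 / poly q x) else 0)"

lemma power_le_fact_exp:
  fixes x :: real
  assumes "0 \<le> x"
  shows "x ^ n \<le> fact n * exp x"
proof -
  have "(\<Sum>k\<in>{n}. x ^ k /\<^sub>R fact k) \<le> (\<Sum>k. x ^ k /\<^sub>R fact k)"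
    using assms by (intro sum_le_suminf summable_exp_generic) auto
  then show ?thesis by (simp add: exp_def field_simps)
qed

text \<open>
  The exponential beats every power of \<open>1 / q\<close>, so that \<open>flat\<close> vanishes to second order, uniformly,
  where \<open>q\<close> vanishes; the constant comes from \<open>y\<^sup>n \<le> n! exp y\<close> at \<open>y = 1 / q\<close>, \<open>n = k + 2\<close>.
\<close>

lemma flat_bound: "\<bar>flat q P k x\<bar> \<le> fact (k + 2) * \<bar>poly P x\<bar> * (poly q x)\<^sup>2"
proof (cases "0 < poly q x")
  case True
  define y where "y = poly q x"
  have y: "0 < y" using True by (simp add: y_def)
  have "1 / y ^ k * exp (- 1 / y) = (1 / y) ^ (k + 2) * (y\<^sup>2 * exp (- (1 / y)))"
    using y by (simp add: power_add power_divide power2_eq_square)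
  also have "\<dots> \<le> (fact (k + 2) * exp (1 / y)) * (y\<^sup>2 * exp (- (1 / y)))"
    using y by (intro mult_right_mono power_le_fact_exp) auto
  also have "\<dots> = fact (k + 2) * y\<^sup>2 * (exp (1 / y) * exp (- (1 / y)))"
    by (simp only: mult_ac)
  also have "\<dots> = fact (k + 2) * y\<^sup>2"
    by (simp only: exp_minus_inverse mult_1_right)
  finally have "\<bar>poly P x\<bar> * (1 / y ^ k * exp (- 1 / y)) \<le> \<bar>poly P x\<bar> * (fact (k + 2) * y\<^sup>2)"
    by (rule mult_left_mono) simp
  moreover have "\<bar>flat q P k x\<bar> = \<bar>poly P x\<bar> * (1 / y ^ k * exp (- 1 / y))"
    using True y by (simp add: flat_def y_def[symmetric] abs_mult)
  ultimately show ?thesis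
    unfolding y_def by (simp only: mult_ac)
qed (simp add: flat_def)

definition flat_step :: "real poly \<Rightarrow> nat \<Rightarrow> real poly \<Rightarrow> real poly" where
  "flat_step q k P = pderiv P * q\<^sup>2 - smult (real k) (P * q * pderiv q) + P * pderiv q"

text \<open>
  Only the zeros of \<open>q\<close> need an argument: there the difference quotient is squeezed to \<open>0\<close> by
  \<open>flat_bound\<close>, since \<open>q(y) / (y - x)\<close> has a limit.
\<close>

lemma flat_has_derivative:
  "(flat q P k has_real_derivative flat q (flat_step q k P) (k + 2) x) (at x)"
proof (cases "poly q x" "0::real" rule: linorder_cases)
  case greater
  \<comment> \<open>The quotient and chain rules produce the left-hand side, \<open>flat_step\<close> the right-hand side.\<close>
  have alg: "(P1 * y ^ k - P0 * (real k * (y1 * y ^ (k - Suc 0)))) / (y ^ k * y ^ k) * E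
       + E * ((0 * y - - 1 * y1) / (y * y)) * (P0 / y ^ k)
     = (P1 * y\<^sup>2 - real k * (P0 * y * y1) + P0 * y1) / y ^ (k + 2) * E"
    if "y \<noteq> 0" for P0 P1 y y1 E :: real
  proof (cases k)
    case 0
    then show ?thesis using that by (simp add: field_simps power2_eq_square)
  next
    case (Suc m)
    define r c where "r = y ^ m" and "c = real (Suc m)"
    have "(P1 * (y * r) - P0 * (c * (y1 * r))) / ((y * r) * (y * r)) * E + E * ((0 * y - - 1 * y1) / (y * y)) * (P0 / (y * r))
      = (P1 * (y * y) - c * (P0 * y * y1) + P0 * y1) / (y * r * (y * y)) * E"
    proof -
      have "r \<noteq> 0" using that by (simp add: r_def)
      then show ?thesis using that by (simp add: divide_simps) (simp add: algebra_simps)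
    qed
    then show ?thesis unfolding Suc r_def c_def by (simp only: power_Suc power2_eq_square power_add diff_Suc_Suc diff_zero)
  qed
  have "((\<lambda>x. poly P x / poly q x ^ k * exp (- 1 / poly q x)) has_real_derivative
      flat q (flat_step q k P) (k + 2) x) (at x)"
    by (rule DERIV_cong[OF DERIV_mult[OF DERIV_divide[OF poly_DERIV DERIV_power[OF poly_DERIV]]
          DERIV_fun_exp[OF DERIV_divide[OF DERIV_const poly_DERIV]]]])
       (use greater alg[of "poly q x"] in \<open>simp_all add: flat_def flat_step_def\<close>)
  then show ?thesis
    by (rule has_field_derivative_transform_within_open[of _ _ _ "{x. 0 < poly q x}"])
       (use greater in \<open>auto simp: flat_def intro!: open_Collect_less continuous_intros\<close>)
next
  case less
  have "((\<lambda>x. 0) has_real_derivative 0) (at x)" by simp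
  then have "(flat q P k has_real_derivative 0) (at x)"
    by (rule has_field_derivative_transform_within_open[of _ _ _ "{x. poly q x < 0}"])
       (use less in \<open>auto simp: flat_def intro!: open_Collect_less continuous_intros\<close>)
  then show ?thesis using less by (simp add: flat_def)
next
  case equal
  have "((\<lambda>y. (poly q y - poly q x) / (y - x)) \<longlongrightarrow> poly (pderiv q) x) (at x)"
    using poly_DERIV[of q x] by (simp add: has_field_derivative_iff)
  then have quot: "((\<lambda>y. poly q y / (y - x)) \<longlongrightarrow> poly (pderiv q) x) (at x)"
    using equal by simp
  have "(\<lambda>y. (flat q P k y - flat q P k x) / (y - x)) \<midarrow>x\<rightarrow> 0"
  proof (rule Lim_null_comparison)
    show "\<forall>\<^sub>F y in at x. norm ((flat q P k y - flat q P k x) / (y - x)) \<le>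
        fact (k + 2) * \<bar>poly P y\<bar> * \<bar>poly q y\<bar> * \<bar>poly q y / (y - x)\<bar>"
    proof (rule always_eventually, rule allI)
      fix y
      have "norm ((flat q P k y - flat q P k x) / (y - x)) = \<bar>flat q P k y\<bar> / \<bar>y - x\<bar>"
        using equal by (simp add: flat_def)
      also have "\<dots> \<le> (fact (k + 2) * \<bar>poly P y\<bar> * (poly q y)\<^sup>2) / \<bar>y - x\<bar>"
        by (intro divide_right_mono flat_bound) auto
      also have "\<dots> = fact (k + 2) * \<bar>poly P y\<bar> * \<bar>poly q y\<bar> * \<bar>poly q y / (y - x)\<bar>"
        by (simp add: power2_eq_square abs_mult[symmetric])
      finally show "norm ((flat q P k y - flat q P k x) / (y - x)) \<le>
        fact (k + 2) * \<bar>poly P y\<bar> * \<bar>poly q y\<bar> * \<bar>poly q y / (y - x)\<bar>" .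
    qed
    have "(\<lambda>y. fact (k + 2) * \<bar>poly P y\<bar> * \<bar>poly q y\<bar> * \<bar>poly q y / (y - x)\<bar>) \<midarrow>x\<rightarrow>
        fact (k + 2) * \<bar>poly P x\<bar> * \<bar>poly q x\<bar> * \<bar>poly (pderiv q) x\<bar>"
      by (intro tendsto_intros quot)
    then show "(\<lambda>y. fact (k + 2) * \<bar>poly P y\<bar> * \<bar>poly q y\<bar> * \<bar>poly q y / (y - x)\<bar>) \<midarrow>x\<rightarrow> 0"
      using equal by simp
  qed
  then show ?thesis using equal by (simp add: has_field_derivative_iff flat_def)
qed

lemma C0_infinity_flat:
  assumes "bounded {x. 0 < poly q x}"
  shows "C0_infinity (\<lambda>x. of_real (flat q 1 0 x))"
proof -
  define P where "P = rec_nat 1 (\<lambda>n. flat_step q (2 * n))"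
  define g where "g n x = complex_of_real (flat q (P n) (2 * n) x)" for n x
  have "(g n has_vector_derivative g (Suc n) x) (at x)" for n x
    unfolding g_def using has_vector_derivative_of_real[OF flat_has_derivative[of q "P n" "2 * n" x]]
    by (simp add: P_def)
  moreover have "g 0 = (\<lambda>x. of_real (flat q 1 0 x))"
    by (simp add: g_def P_def fun_eq_iff)
  moreover have "compact (closure {x. 0 < poly q x})" using assms by (simp add: compact_closure)
  moreover have "complex_of_real (flat q 1 0 x) = 0" if "x \<notin> closure {x. 0 < poly q x}" for x
  proof -
    have "\<not> 0 < poly q x" using that subsetD[OF closure_subset, of x "{x. 0 < poly q x}"] by auto
    then show ?thesis by (simp add: flat_def)
  qed
  ultimately show ?thesis unfolding C0_infinity_def by blast
qed

text \<open>
  With \<open>q = (n + 1) (x - a) (b - x)\<close>, the bump \<open>exp (- 1 / q)\<close> lives on \<open>(a, b)\<close> and tends to \<open>1\<close> there as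
  \<open>n\<close> grows.
\<close>

lemma C0_infinity_approx_indicator:
  fixes a b :: real
  obtains h :: "nat \<Rightarrow> real \<Rightarrow> real" where "\<And>n. C0_infinity (\<lambda>x. of_real (h n x))"
    "\<And>n x. 0 \<le> h n x" "\<And>n x. h n x \<le> indicator {a<..<b} x"
    "\<And>x. (\<lambda>n. h n x) \<longlonglongrightarrow> indicator {a<..<b} x"
proof (cases "a < b")
  case True
  define q where "q n = smult (real (Suc n)) [:- a * b, a + b, - 1:]" for n
  have q: "poly (q n) x = real (Suc n) * ((x - a) * (b - x))" for n x
    by (simp add: q_def algebra_simps)
  have pos: "0 < poly (q n) x \<longleftrightarrow> x \<in> {a<..<b}" for n x
    using True unfolding q by (auto simp: zero_less_mult_iff)
  show thesis
  proof (rule that[of "\<lambda>n. flat (q n) 1 0"])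
    have "bounded {x. 0 < poly (q n) x}" for n
      by (rule bounded_subset[OF bounded_cbox[of a b]]) (simp add: pos subset_eq)
    then show "C0_infinity (\<lambda>x. of_real (flat (q n) 1 0 x))" for n
      by (rule C0_infinity_flat)
    show "0 \<le> flat (q n) 1 0 x" "flat (q n) 1 0 x \<le> indicator {a<..<b} x" for n x
      using pos[of n x] by (auto simp: flat_def)
    show "(\<lambda>n. flat (q n) 1 0 x) \<longlonglongrightarrow> indicator {a<..<b} x" for x
    proof (cases "x \<in> {a<..<b}")
      case x: True
      have "(\<lambda>n. - (1 / ((x - a) * (b - x))) * (1 / real (Suc n))) \<longlonglongrightarrow> - (1 / ((x - a) * (b - x))) * 0"
        by (intro tendsto_mult tendsto_const LIMSEQ_inverse_real_of_nat[unfolded inverse_eq_divide])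
      from tendsto_exp[OF this] have "(\<lambda>n. exp (- 1 / poly (q n) x)) \<longlonglongrightarrow> 1"
        unfolding q by (simp add: mult.commute)
      then show ?thesis using x pos by (simp add: flat_def)
    next
      case False
      then have "flat (q n) 1 0 x = 0" for n using pos[of n x] by (simp add: flat_def)
      then show ?thesis using False by simp
    qed
  qed
next
  case False
  have "C0_infinity (\<lambda>x. of_real 0)"
    unfolding C0_infinity_def by (auto intro!: exI[of _ "\<lambda>n x. 0"] exI[of _ "{}"])
  then show thesis using False by (intro that[of "\<lambda>n x. 0"]) auto
qed

section \<open>The measure space \<open>RT\<close> and its \<open>p\<close>-th power integrals\<close>

lemma space_RT: "space RT = UNIV \<times> {0..<1}"
  by (simp add: RT_def space_pair_measure space_restrict_space)

lemma borel_measurable_RT: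
  assumes "f \<in> borel_measurable borel"
  shows "f \<in> borel_measurable RT"
proof -
  have "fst \<in> RT \<rightarrow>\<^sub>M borel" "snd \<in> RT \<rightarrow>\<^sub>M restrict_space lborel {0..<1}"
    unfolding RT_def using measurable_fst measurable_snd by auto
  moreover have "(\<lambda>x. x) \<in> restrict_space lborel {0..<1::real} \<rightarrow>\<^sub>M borel"
    by (rule measurable_restrict_space1) simp
  ultimately have "(\<lambda>w. (fst w, snd w)) \<in> RT \<rightarrow>\<^sub>M borel \<Otimes>\<^sub>M borel"
    by (intro measurable_Pair) (auto dest: measurable_compose)
  then have "(\<lambda>w. w) \<in> RT \<rightarrow>\<^sub>M borel" by (simp add: borel_prod)
  from measurable_compose[OF this assms] show ?thesis by simp
qed

lemma borel_measurable_RT_continuous: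
  "continuous_on UNIV f \<Longrightarrow> f \<in> borel_measurable RT"
  by (intro borel_measurable_RT borel_measurable_continuous_onI)

text \<open>
  The strip is a Borel subset of the plane, so measurable sets of \<open>RT\<close> are Borel sets and can be
  reached by a Dynkin argument over boxes of the plane.
\<close>

lemma sets_RT_subset_borel: "A \<in> sets RT \<Longrightarrow> A \<in> sets borel"
proof -
  have "a \<times> b \<in> sets borel" if "a \<in> sets lborel" "b \<in> sets (restrict_space lborel {0..<1::real})"
    for a :: "real set" and b
  proof -
    have "b \<in> sets borel" using that(2) by (auto simp: sets_restrict_space)
    then have "a \<times> b \<in> sets (borel \<Otimes>\<^sub>M borel)" using that(1) by (intro pair_measureI) auto
    then show ?thesis unfolding borel_prod .
  qed
  then have gen: "a \<in> sets borel" if "a \<in> {a \<times> b |a b. a \<in> sets lborel \<and> b \<in> sets (restrict_space lborel {0..<1::real})}" for a :: "(real \<times> real) set"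
    using that by blast
  have "(UNIV :: real set) \<times> {0..<1::real} \<in> sets (borel \<Otimes>\<^sub>M borel)" by (intro pair_measureI) auto
  then have strip: "(UNIV :: real set) \<times> {0..<1::real} \<in> sets borel" unfolding borel_prod .
  assume "A \<in> sets RT"
  then have "A \<in> sigma_sets (UNIV \<times> {0..<1}) {a \<times> b |a b. a \<in> sets lborel \<and> b \<in> sets (restrict_space lborel {0..<1::real})}"
    unfolding RT_def sets_pair_measure by (simp add: space_restrict_space)
  then show "A \<in> sets borel"
    by induction (use gen strip in \<open>auto intro!: sets.Diff\<close>)
qed

lemma nn_integral_RT_fst:
  assumes "w \<in> borel_measurable borel"
  shows "(\<integral>\<^sup>+z. w (fst z) \<partial>RT) = (\<integral>\<^sup>+x. w x \<partial>lborel)"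
proof -
  interpret T: sigma_finite_measure "restrict_space lborel {0..<1::real}"
    by (intro sigma_finite_measure_restrict_space lborel.sigma_finite_measure_axioms) auto
  have "(\<lambda>z. w (fst z)) \<in> borel_measurable (lborel \<Otimes>\<^sub>M restrict_space lborel {0..<1::real})"
    using assms by (intro measurable_compose[OF measurable_fst]) auto
  then have "(\<integral>\<^sup>+z. w (fst z) \<partial>RT) = (\<integral>\<^sup>+x. \<integral>\<^sup>+y. w x \<partial>restrict_space lborel {0..<1::real} \<partial>lborel)"
    unfolding RT_def by (subst T.nn_integral_fst[symmetric]) auto
  then show ?thesis by (simp add: emeasure_restrict_space space_restrict_space)
qed

text \<open>
  The end point \<open>0\<close> of the fundamental domain lies in no open interval contained in \<open>[0, 1]\<close>; being
  a null set, it can be ignored.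
\<close>

lemma AE_RT_snd_nonzero: "AE w in RT. snd w \<noteq> 0"
proof -
  interpret T: sigma_finite_measure "restrict_space lborel {0..<1::real}"
    by (intro sigma_finite_measure_restrict_space lborel.sigma_finite_measure_axioms) auto
  have 0: "{0::real} \<in> sets (restrict_space lborel {0..<1})"
    by (auto simp: sets_restrict_space intro!: image_eqI[of _ _ "{0}"])
  have "emeasure RT (UNIV \<times> {0}) = emeasure lborel (UNIV::real set) * emeasure (restrict_space lborel {0..<1}) {0::real}"
    unfolding RT_def using 0 by (intro T.emeasure_pair_measure_Times) auto
  also have "\<dots> = 0" by (simp add: emeasure_restrict_space)
  finally have "UNIV \<times> {0} \<in> null_sets RT"
    using 0 unfolding RT_def by (intro null_setsI pair_measureI) auto
  then show ?thesis by (rule AE_I') auto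
qed

lemma powr_add_le:
  fixes a b p :: real
  assumes "0 \<le> a" "0 \<le> b" "0 < p"
  shows "(a + b) powr p \<le> 2 powr p * (a powr p + b powr p)"
proof -
  have "(a + b) powr p \<le> (2 * max a b) powr p"
    using assms by (intro powr_mono2) auto
  also have "\<dots> = 2 powr p * (max a b powr p)" using assms by (simp add: powr_mult)
  also have "max a b powr p \<le> a powr p + b powr p"
    by (auto simp: max_def)
  finally show ?thesis by (simp add: mult_left_mono)
qed

lemma RT_norm_pow_add_le:
  assumes "0 < p" "f \<in> borel_measurable RT" "g \<in> borel_measurable RT"
  shows "RT_norm_pow p (\<lambda>w. f w + g w) \<le> ennreal (2 powr p) * (RT_norm_pow p f + RT_norm_pow p g)"
proof -
  have "ennreal (cmod (f w + g w) powr p)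
      \<le> ennreal (2 powr p) * (ennreal (cmod (f w) powr p) + ennreal (cmod (g w) powr p))" for w
  proof -
    have "cmod (f w + g w) powr p \<le> (cmod (f w) + cmod (g w)) powr p"
      using assms by (intro powr_mono2 norm_triangle_ineq) auto
    also have "\<dots> \<le> 2 powr p * (cmod (f w) powr p + cmod (g w) powr p)"
      using assms by (intro powr_add_le) auto
    finally show ?thesis by (simp add: ennreal_mult[symmetric] ennreal_plus[symmetric] ennreal_leI del: ennreal_plus)
  qed
  then have "RT_norm_pow p (\<lambda>w. f w + g w)
      \<le> (\<integral>\<^sup>+w. ennreal (2 powr p) * (ennreal (cmod (f w) powr p) + ennreal (cmod (g w) powr p)) \<partial>RT)"
    unfolding RT_norm_pow_def by (intro nn_integral_mono)
  also have "\<dots> = ennreal (2 powr p) * (RT_norm_pow p f + RT_norm_pow p g)"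
    unfolding RT_norm_pow_def using assms(2,3)
    by (subst nn_integral_cmult; (subst nn_integral_add)?) auto
  finally show ?thesis .
qed

lemma RT_norm_pow_scale:
  assumes "f \<in> borel_measurable RT"
  shows "RT_norm_pow p (\<lambda>w. c * f w) = ennreal (cmod c powr p) * RT_norm_pow p f"
  unfolding RT_norm_pow_def using assms
  by (subst nn_integral_cmult[symmetric]) (auto simp: norm_mult powr_mult ennreal_mult)

lemma RT_norm_pow_minus: "RT_norm_pow p (\<lambda>w. - f w) = RT_norm_pow p f"
  by (simp add: RT_norm_pow_def)

lemma RT_norm_pow_cong_AE:
  "(AE w in RT. f w = g w) \<Longrightarrow> RT_norm_pow p f = RT_norm_pow p g"
  unfolding RT_norm_pow_def by (intro nn_integral_cong_AE) auto

text \<open>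
  Dominated convergence in norm; \<open>v - u n\<close> is dominated by \<open>2 w\<close> because the limit inherits the bound
  \<open>w\<close>.
\<close>

lemma RT_norm_pow_dominated:
  assumes "0 < p" and [measurable]: "\<And>n. u n \<in> borel_measurable RT" "v \<in> borel_measurable RT"
      "w \<in> borel_measurable RT"
    and bnd: "\<And>n. AE z in RT. cmod (u n z) \<le> w z"
    and w: "(\<integral>\<^sup>+z. ennreal (w z powr p) \<partial>RT) < \<infinity>"
    and lim: "AE z in RT. (\<lambda>n. u n z) \<longlonglongrightarrow> v z"
  shows "(\<lambda>n. RT_norm_pow p (\<lambda>z. v z - u n z)) \<longlonglongrightarrow> 0"
proof -
  have bnd': "AE z in RT. \<forall>n. cmod (u n z) \<le> w z"
    unfolding AE_all_countable using bnd by blast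
  have "(\<lambda>n. RT_norm_pow p (\<lambda>z. v z - u n z)) \<longlonglongrightarrow> (\<integral>\<^sup>+z. 0 \<partial>RT)"
    unfolding RT_norm_pow_def
  proof (rule nn_integral_dominated_convergence)
    show "(\<lambda>z. ennreal (2 powr p * w z powr p)) \<in> borel_measurable RT"
      "\<And>n. (\<lambda>z. ennreal (cmod (v z - u n z) powr p)) \<in> borel_measurable RT" by measurable
    show "AE z in RT. ennreal (cmod (v z - u n z) powr p) \<le> ennreal (2 powr p * w z powr p)" for n
      using bnd' lim
    proof eventually_elim
      case (elim z)
      have "cmod (v z) \<le> w z"
        using elim by (intro Lim_bounded[OF tendsto_norm[OF elim(2)]]) auto
      then have "cmod (v z - u n z) \<le> 2 * w z"
        using elim(1) norm_triangle_ineq4[of "v z" "u n z"] by (smt (verit, best))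
      then have "cmod (v z - u n z) powr p \<le> (2 * w z) powr p"
        using assms(1) by (intro powr_mono2) auto
      moreover have "0 \<le> w z" using \<open>cmod (v z) \<le> w z\<close> norm_ge_zero order_trans by blast
      ultimately show ?case by (intro ennreal_leI) (simp add: powr_mult)
    qed
    have "(\<integral>\<^sup>+z. ennreal (2 powr p * w z powr p) \<partial>RT) = ennreal (2 powr p) * (\<integral>\<^sup>+z. ennreal (w z powr p) \<partial>RT)"
      by (subst nn_integral_cmult[symmetric]) (auto simp: ennreal_mult)
    then show "(\<integral>\<^sup>+z. ennreal (2 powr p * w z powr p) \<partial>RT) < \<infinity>"
      using w by (simp add: ennreal_mult_less_top)
    show "AE z in RT. (\<lambda>n. ennreal (cmod (v z - u n z) powr p)) \<longlonglongrightarrow> 0"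
      using lim
    proof eventually_elim
      case (elim z)
      have "(\<lambda>n. cmod (v z - u n z)) \<longlonglongrightarrow> cmod (v z - v z)" by (intro tendsto_intros elim)
      then have "(\<lambda>n. cmod (v z - u n z) powr p) \<longlonglongrightarrow> 0"
        using assms(1) by (intro tendsto_zero_powrI) auto
      then show ?case using tendsto_ennrealI by fastforce
    qed
  qed auto
  then show ?thesis by simp
qed

section \<open>Trigonometric polynomials and arcs\<close>

inductive_set trig_poly :: "(real \<Rightarrow> complex) set" where
  monomial: "(\<lambda>\<gamma>. c * cis (2 * pi * of_int j * \<gamma>)) \<in> trig_poly"
| add: "f \<in> trig_poly \<Longrightarrow> g \<in> trig_poly \<Longrightarrow> (\<lambda>\<gamma>. f \<gamma> + g \<gamma>) \<in> trig_poly"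

lemma trig_poly_const: "(\<lambda>_. c) \<in> trig_poly"
  using trig_poly.monomial[of c 0] by simp

lemma trig_poly_mult:
  assumes "f \<in> trig_poly" "g \<in> trig_poly"
  shows "(\<lambda>\<gamma>. f \<gamma> * g \<gamma>) \<in> trig_poly"
  using assms(1)
proof induction
  case (monomial c j)
  show ?case using assms(2)
  proof induction
    case (monomial d k)
    have "(\<lambda>\<gamma>. (c * cis (2 * pi * of_int j * \<gamma>)) * (d * cis (2 * pi * of_int k * \<gamma>)))
      = (\<lambda>\<gamma>. c * d * cis (2 * pi * of_int (j + k) * \<gamma>))"
      by (simp add: fun_eq_iff algebra_simps flip: cis_mult)
    then show ?case by (simp only: trig_poly.monomial)
  qed (simp add: distrib_left trig_poly.add)
qed (simp add: distrib_right trig_poly.add)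

lemma trig_poly_cos: "(\<lambda>\<gamma>. of_real (cos (2 * pi * \<gamma> - \<theta>))) \<in> trig_poly"
proof -
  have half_sum: "(cis x + cis (- x)) / 2 = of_real (cos x)" for x
    by (simp add: complex_eq_iff)
  have "(\<lambda>\<gamma>. of_real (cos (2 * pi * \<gamma> - \<theta>))) =
     (\<lambda>\<gamma>. cis (- \<theta>) / 2 * cis (2 * pi * of_int 1 * \<gamma>) + cis \<theta> / 2 * cis (2 * pi * of_int (- 1) * \<gamma>))"
  proof
    fix \<gamma>
    have "cis (- \<theta>) / 2 * cis (2 * pi * of_int 1 * \<gamma>) + cis \<theta> / 2 * cis (2 * pi * of_int (- 1) * \<gamma>)
      = (cis (2 * pi * \<gamma> - \<theta>) + cis (- (2 * pi * \<gamma> - \<theta>))) / 2"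
      by (simp add: cis_mult add_divide_distrib algebra_simps)
    also have "\<dots> = of_real (cos (2 * pi * \<gamma> - \<theta>))"
      using half_sum[of "2 * pi * \<gamma> - \<theta>"] .
    finally show "of_real (cos (2 * pi * \<gamma> - \<theta>)) = cis (- \<theta>) / 2 * cis (2 * pi * of_int 1 * \<gamma>) + cis \<theta> / 2 * cis (2 * pi * of_int (- 1) * \<gamma>)" ..
  qed
  then show ?thesis by (simp only: trig_poly.intros)
qed

text \<open>
  This trigonometric polynomial of degree one equals \<open>2 sin (\<pi> (\<gamma> - c)) sin (\<pi> (d - \<gamma>))\<close>. Its sign
  singles out the arc from \<open>c\<close> to \<open>d\<close>.
\<close>

definition arc_fun :: "real \<Rightarrow> real \<Rightarrow> real \<Rightarrow> real" where
  "arc_fun c d \<gamma> = cos (2 * pi * \<gamma> - pi * (c + d)) - cos (pi * (d - c))"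

lemma arc_fun_pos_iff:
  assumes "0 \<le> c" "c \<le> d" "d \<le> 1" "\<gamma> \<in> {0..<1}"
  shows "0 < arc_fun c d \<gamma> \<longleftrightarrow> \<gamma> \<in> {c<..<d}"
proof -
  have eq: "arc_fun c d \<gamma> = 2 * sin (pi * (\<gamma> - c)) * sin (pi * (d - \<gamma>))"
    unfolding arc_fun_def cos_diff_cos by (simp add: algebra_simps diff_divide_distrib add_divide_distrib)
  have pos: "0 \<le> sin (pi * x)" if "0 \<le> x" "x \<le> 1" for x
    using that by (intro sin_ge_zero) (auto simp: mult_left_le)
  have spos: "0 < sin (pi * x)" if "0 < x" "x < 1" for x
    using that by (intro sin_gt_zero) auto
  have neg: "sin (pi * x) \<le> 0" if "- 1 \<le> x" "x \<le> 0" for x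
    using pos[of "- x"] that by simp
  consider "\<gamma> \<le> c" | "d \<le> \<gamma>" | "c < \<gamma>" "\<gamma> < d" by linarith
  then show ?thesis
  proof cases
    case 1
    then have "arc_fun c d \<gamma> \<le> 0"
      unfolding eq using assms neg[of "\<gamma> - c"] pos[of "d - \<gamma>"] by (intro mult_nonpos_nonneg[of "2 * _"]) auto
    then show ?thesis using 1 by auto
  next
    case 2
    then have "arc_fun c d \<gamma> \<le> 0"
      unfolding eq using assms pos[of "\<gamma> - c"] neg[of "d - \<gamma>"] by (intro mult_nonneg_nonpos[of "2 * _"]) auto
    then show ?thesis using 2 by auto
  next
    case 3
    then have "0 < arc_fun c d \<gamma>"
      unfolding eq using assms spos[of "\<gamma> - c"] spos[of "d - \<gamma>"] by (intro mult_pos_pos) auto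
    then show ?thesis using 3 by auto
  qed
qed

lemma trig_poly_arc_fun: "(\<lambda>\<gamma>. of_real (arc_fun c d \<gamma>)) \<in> trig_poly"
proof -
  have "(\<lambda>\<gamma>. complex_of_real (arc_fun c d \<gamma>)) = (\<lambda>\<gamma>. of_real (cos (2 * pi * \<gamma> - pi * (c + d))) + of_real (- cos (pi * (d - c))))"
    by (simp add: arc_fun_def fun_eq_iff)
  then show ?thesis by (simp only: trig_poly.add trig_poly_cos trig_poly_const)
qed

lemma arc_fun_bounds: "arc_fun c d \<gamma> \<in> {-2..2}"
  unfolding arc_fun_def
  using cos_le_one[of "2 * pi * \<gamma> - pi * (c + d)"] cos_ge_minus_one[of "2 * pi * \<gamma> - pi * (c + d)"]
    cos_le_one[of "pi * (d - c)"] cos_ge_minus_one[of "pi * (d - c)"] by (simp only: atLeastAtMost_iff) linarith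

text \<open>
  The functions \<open>f\<close> for which \<open>f \<circ> arc_fun c d\<close> is a trigonometric polynomial form an algebra that
  contains the identity, hence separates points, so the Stone--Weierstrass theorem applies on the
  interval \<open>[-2, 2]\<close> containing all values of \<open>arc_fun\<close>.
\<close>

lemma trig_poly_uniform_approx:
  fixes G :: "real \<Rightarrow> real"
  assumes G: "continuous_on {-2..2} G" and "0 < e"
  shows "\<exists>\<tau>\<in>trig_poly. \<forall>\<gamma>. cmod (of_real (G (arc_fun c d \<gamma>)) - \<tau> \<gamma>) < e"
proof -
  let ?P = "\<lambda>f. continuous_on {-2..2} f \<and> (\<lambda>\<gamma>. complex_of_real (f (arc_fun c d \<gamma>))) \<in> trig_poly"
  have "\<exists>g. ?P g \<and> (\<forall>x\<in>{-2..2}. \<bar>G x - g x\<bar> < e)"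
  proof (rule Stone_Weierstrass_HOL)
    show "\<exists>f. ?P f \<and> f x \<noteq> f y" if "x \<in> {-2..2} \<and> y \<in> {-2..2} \<and> x \<noteq> y" for x y
      using that trig_poly_arc_fun by (intro exI[of _ "\<lambda>x. x"]) auto
  qed (auto intro!: continuous_intros trig_poly_const trig_poly.add trig_poly_mult G \<open>0 < e\<close>)
  then obtain g where g: "?P g" "\<And>x. x \<in> {-2..2} \<Longrightarrow> \<bar>G x - g x\<bar> < e" by blast
  have "cmod (of_real (G (arc_fun c d \<gamma>)) - of_real (g (arc_fun c d \<gamma>))) < e" for \<gamma>
    using g(2)[OF arc_fun_bounds] by (simp flip: of_real_diff)
  then show ?thesis using g(1) by (intro bexI[of _ "\<lambda>\<gamma>. of_real (g (arc_fun c d \<gamma>))"]) auto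
qed


section \<open>Density of test functions times trigonometric polynomials\<close>

lemma C0_infinity_continuous: "C0_infinity f \<Longrightarrow> continuous_on UNIV f"
  by (metis C0_infinityE)

lemma C0_infinity_zero: "C0_infinity (\<lambda>x. 0)"
  unfolding C0_infinity_def by (auto intro!: exI[of _ "\<lambda>n x. 0"] exI[of _ "{}"])

lemma C0_infinity_add:
  assumes "C0_infinity f" "C0_infinity f'"
  shows "C0_infinity (\<lambda>x. f x + f' x)"
proof -
  obtain g K where g: "g 0 = f" "\<And>n x. (g n has_vector_derivative g (Suc n) x) (at x)"
    "compact K" "\<And>x. x \<notin> K \<Longrightarrow> f x = 0"
    using assms(1) unfolding C0_infinity_def by metis
  obtain g' K' where g': "g' 0 = f'" "\<And>n x. (g' n has_vector_derivative g' (Suc n) x) (at x)"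
    "compact K'" "\<And>x. x \<notin> K' \<Longrightarrow> f' x = 0"
    using assms(2) unfolding C0_infinity_def by metis
  show ?thesis
    unfolding C0_infinity_def using g g'
    by (intro conjI exI[of _ "\<lambda>n x. g n x + g' n x"] exI[of _ "K \<union> K'"])
       (auto intro!: has_vector_derivative_add compact_Un)
qed

lemma C0_infinity_scale:
  assumes "C0_infinity f"
  shows "C0_infinity (\<lambda>x. a * f x)"
proof -
  obtain g K where g: "g 0 = f" "\<And>n x. (g n has_vector_derivative g (Suc n) x) (at x)"
    "compact K" "\<And>x. x \<notin> K \<Longrightarrow> f x = 0"
    using assms(1) unfolding C0_infinity_def by metis
  show ?thesis
    unfolding C0_infinity_def using g
    by (intro conjI exI[of _ "\<lambda>n x. a * g n x"] exI[of _ "K"])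
       (auto intro!: has_vector_derivative_mult_right)
qed

text \<open>
  The components of the elements of \<open>dense_class\<close>, generated without reference to a degree.
\<close>

inductive_set smooth_trig :: "(real \<times> real \<Rightarrow> complex) set" where
  monomial: "C0_infinity h \<Longrightarrow> (\<lambda>w. h (fst w) * cis (2 * pi * of_int j * snd w)) \<in> smooth_trig"
| add: "f \<in> smooth_trig \<Longrightarrow> g \<in> smooth_trig \<Longrightarrow> (\<lambda>w. f w + g w) \<in> smooth_trig"

lemma smooth_trig_scale: "f \<in> smooth_trig \<Longrightarrow> (\<lambda>w. a * f w) \<in> smooth_trig"
proof (induction rule: smooth_trig.induct)
  case (monomial h j)
  then show ?case
    using smooth_trig.monomial[OF C0_infinity_scale, of h a j] by (simp add: mult.assoc)
qed (simp add: distrib_left smooth_trig.add)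

lemma smooth_trig_product:
  assumes h: "C0_infinity h" and "\<tau> \<in> trig_poly"
  shows "(\<lambda>w. h (fst w) * \<tau> (snd w)) \<in> smooth_trig"
  using assms(2)
proof induction
  case (monomial c j)
  then show ?case
    using smooth_trig.monomial[OF C0_infinity_scale[OF h, of c], of j] by (simp add: mult_ac)
qed (simp add: distrib_left smooth_trig.add)

lemma smooth_trig_measurable: "f \<in> smooth_trig \<Longrightarrow> f \<in> borel_measurable RT"
proof (induction rule: smooth_trig.induct)
  case (monomial h j)
  then show ?case
    by (intro borel_measurable_RT_continuous continuous_intros
        continuous_on_compose2[OF C0_infinity_continuous]) auto
qed auto

text \<open>
  Membership in the closure of \<open>smooth_trig\<close> in the \<open>p\<close>-th power mean.
\<close>

definition approximable :: "real \<Rightarrow> (real \<times> real \<Rightarrow> complex) \<Rightarrow> bool" where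
  "approximable p f \<longleftrightarrow> f \<in> borel_measurable RT \<and>
     (\<forall>e>0. \<exists>g\<in>smooth_trig. RT_norm_pow p (\<lambda>w. f w - g w) < ennreal e)"

lemma RT_norm_pow_zero: "RT_norm_pow p (\<lambda>w. 0) = 0"
  by (simp add: RT_norm_pow_def)

lemma approximable_smooth_trig: "f \<in> smooth_trig \<Longrightarrow> approximable p f"
  unfolding approximable_def
  by (auto simp: smooth_trig_measurable RT_norm_pow_zero intro!: bexI[of _ f])

text \<open>
  The constant \<open>2 * 2 powr p\<close> makes up for the factor that the quasi-triangle inequality costs.
\<close>

lemma RT_norm_pow_triangle:
  assumes "0 < p" "f \<in> borel_measurable RT" "g \<in> borel_measurable RT" "h \<in> borel_measurable RT"
    and "RT_norm_pow p (\<lambda>w. f w - g w) < ennreal (e / (2 * 2 powr p))"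
    and "RT_norm_pow p (\<lambda>w. g w - h w) < ennreal (e / (2 * 2 powr p))"
  shows "RT_norm_pow p (\<lambda>w. f w - h w) < ennreal e"
proof -
  let ?d = "e / (2 * 2 powr p)"
  have e: "0 < e"
  proof (rule ccontr)
    assume "\<not> 0 < e"
    then have "ennreal ?d = 0" by (intro ennreal_neg) (simp add: divide_nonpos_pos)
    then show False using assms(5) by simp
  qed
  have "RT_norm_pow p (\<lambda>w. f w - h w) = RT_norm_pow p (\<lambda>w. (f w - g w) + (g w - h w))" by simp
  also have "\<dots> \<le> ennreal (2 powr p) * (RT_norm_pow p (\<lambda>w. f w - g w) + RT_norm_pow p (\<lambda>w. g w - h w))"
    using assms by (intro RT_norm_pow_add_le) auto
  also have "\<dots> < ennreal (2 powr p) * (ennreal ?d + ennreal ?d)"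
    using assms(5,6) by (intro ennreal_mult_strict_left_mono add_strict_mono) auto
  also have "\<dots> = ennreal e"
    using e by (simp add: ennreal_mult[symmetric] ennreal_plus[symmetric] del: ennreal_plus)
  finally show ?thesis .
qed

lemma approximableI:
  assumes "0 < p" "f \<in> borel_measurable RT"
    and "\<And>e. 0 < e \<Longrightarrow> \<exists>g. approximable p g \<and> RT_norm_pow p (\<lambda>w. f w - g w) < ennreal e"
  shows "approximable p f"
  unfolding approximable_def
proof (intro conjI allI impI)
  fix e :: real assume "0 < e"
  then have d: "0 < e / (2 * 2 powr p)" by simp
  obtain g where g: "approximable p g" "RT_norm_pow p (\<lambda>w. f w - g w) < ennreal (e / (2 * 2 powr p))"
    using assms(3)[OF d] by blast
  obtain h where h: "h \<in> smooth_trig" "RT_norm_pow p (\<lambda>w. g w - h w) < ennreal (e / (2 * 2 powr p))"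
    using g(1) d unfolding approximable_def by blast
  have "RT_norm_pow p (\<lambda>w. f w - h w) < ennreal e"
    using assms g h by (intro RT_norm_pow_triangle[of p f g h]) (auto simp: approximable_def smooth_trig_measurable)
  then show "\<exists>g\<in>smooth_trig. RT_norm_pow p (\<lambda>w. f w - g w) < ennreal e" using h by blast
qed fact

lemma approximable_dominated:
  assumes "0 < p" "\<And>n. approximable p (u n)" "v \<in> borel_measurable RT" "w \<in> borel_measurable RT"
    and "\<And>n. AE z in RT. cmod (u n z) \<le> w z"
    and "(\<integral>\<^sup>+z. ennreal (w z powr p) \<partial>RT) < \<infinity>"
    and "AE z in RT. (\<lambda>n. u n z) \<longlonglongrightarrow> v z"
  shows "approximable p v"
proof (rule approximableI)
  fix e :: real assume "0 < e"
  have "(\<lambda>n. RT_norm_pow p (\<lambda>z. v z - u n z)) \<longlonglongrightarrow> 0"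
    using assms by (intro RT_norm_pow_dominated[where w=w]) (auto simp: approximable_def)
  then have "\<forall>\<^sub>F n in sequentially. RT_norm_pow p (\<lambda>z. v z - u n z) < ennreal e"
    using \<open>0 < e\<close> by (intro order_tendstoD) auto
  then show "\<exists>g. approximable p g \<and> RT_norm_pow p (\<lambda>w. v w - g w) < ennreal e"
    using assms(2) eventually_happens' sequentially_bot by blast
qed (use assms in auto)

lemma approximable_add:
  assumes "0 < p" "approximable p f" "approximable p g"
  shows "approximable p (\<lambda>w. f w + g w)"
  unfolding approximable_def
proof (intro conjI allI impI)
  show "(\<lambda>w. f w + g w) \<in> borel_measurable RT" using assms by (auto simp: approximable_def)
  fix e :: real assume "0 < e"
  then have d: "0 < e / (2 * 2 powr p)" by simp
  obtain f' where f': "f' \<in> smooth_trig" "RT_norm_pow p (\<lambda>w. f w - f' w) < ennreal (e / (2 * 2 powr p))"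
    using assms(2) d unfolding approximable_def by blast
  obtain g' where g': "g' \<in> smooth_trig" "RT_norm_pow p (\<lambda>w. g w - g' w) < ennreal (e / (2 * 2 powr p))"
    using assms(3) d unfolding approximable_def by blast
  have eq: "(\<lambda>w. f w + g w - (f' w + g w)) = (\<lambda>w. f w - f' w)" "(\<lambda>w. f' w + g w - (f' w + g' w)) = (\<lambda>w. g w - g' w)"
    by simp_all
  have [measurable]: "f \<in> borel_measurable RT" "g \<in> borel_measurable RT"
    "f' \<in> borel_measurable RT" "g' \<in> borel_measurable RT"
    using assms f' g' by (simp_all add: approximable_def smooth_trig_measurable)
  have "RT_norm_pow p (\<lambda>w. (f w + g w) - (f' w + g' w)) < ennreal e"
    by (rule RT_norm_pow_triangle[of p _ "\<lambda>w. f' w + g w", OF assms(1)], unfold eq) (measurable, fact+)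
  then show "\<exists>h\<in>smooth_trig. RT_norm_pow p (\<lambda>w. f w + g w - h w) < ennreal e"
    using smooth_trig.add[OF f'(1) g'(1)] by (rule bexI)
qed

lemma approximable_scale:
  assumes "approximable p f"
  shows "approximable p (\<lambda>w. a * f w)"
  unfolding approximable_def
proof (intro conjI allI impI)
  have [measurable]: "f \<in> borel_measurable RT" using assms by (simp add: approximable_def)
  show "(\<lambda>w. a * f w) \<in> borel_measurable RT" by measurable
  fix e :: real assume e: "0 < e"
  define A where "A = cmod a powr p + 1"
  have A: "0 < A" by (simp add: A_def add_nonneg_pos)
  obtain g where g: "g \<in> smooth_trig" "RT_norm_pow p (\<lambda>w. f w - g w) < ennreal (e / A)"
    using assms e A unfolding approximable_def by (meson divide_pos_pos)
  have [measurable]: "g \<in> borel_measurable RT" using g by (simp add: smooth_trig_measurable)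
  have "RT_norm_pow p (\<lambda>w. a * f w - a * g w) = RT_norm_pow p (\<lambda>w. a * (f w - g w))"
    by (simp add: algebra_simps)
  also have "\<dots> = ennreal (cmod a powr p) * RT_norm_pow p (\<lambda>w. f w - g w)"
    by (rule RT_norm_pow_scale) measurable
  also have "\<dots> \<le> ennreal A * RT_norm_pow p (\<lambda>w. f w - g w)"
    by (intro mult_right_mono ennreal_leI) (auto simp: A_def)
  also have "\<dots> < ennreal A * ennreal (e / A)"
    using g(2) A by (intro ennreal_mult_strict_left_mono) auto
  also have "\<dots> = ennreal e" using A e by (simp add: ennreal_mult[symmetric])
  finally show "\<exists>h\<in>smooth_trig. RT_norm_pow p (\<lambda>w. a * f w - h w) < ennreal e"
    using smooth_trig_scale[OF g(1), of a] by (intro bexI[of _ "\<lambda>w. a * g w"])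
qed

lemma approximable_cong_AE:
  assumes "approximable p f" "AE w in RT. f w = g w" "g \<in> borel_measurable RT"
  shows "approximable p g"
proof -
  have "RT_norm_pow p (\<lambda>w. g w - h w) = RT_norm_pow p (\<lambda>w. f w - h w)" for h
    using assms(2) by (intro RT_norm_pow_cong_AE) auto
  then show ?thesis using assms by (simp add: approximable_def)
qed

lemma approximable_zero: "approximable p (\<lambda>w. 0)"
  using approximable_smooth_trig[OF smooth_trig.monomial[OF C0_infinity_zero, of 0]] by simp

lemma approximable_sum:
  assumes "0 < p" "\<And>i. i \<in> I \<Longrightarrow> approximable p (f i)"
  shows "approximable p (\<lambda>w. \<Sum>i\<in>I. f i w)"
  using assms(2)
  by (induction I rule: infinite_finite_induct)
     (auto simp: approximable_zero intro!: approximable_add assms(1))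

lemma measurable_RT_coords [measurable]: "fst \<in> borel_measurable RT" "snd \<in> borel_measurable RT"
  by (intro borel_measurable_RT_continuous continuous_intros)+

lemma RT_indicator_measurable:
  assumes "A \<in> sets borel"
  shows "(\<lambda>w. complex_of_real (indicator A w)) \<in> borel_measurable RT"
proof -
  have "(\<lambda>x. complex_of_real x) \<in> borel_measurable borel"
    by (intro borel_measurable_continuous_onI continuous_on_of_real continuous_on_id)
  from measurable_compose[OF borel_measurable_indicator[OF assms] this] show ?thesis
    by (rule borel_measurable_RT)
qed

text \<open>
  The indicator of the rectangle is reached in two limits. A product of a bump function with
  \<open>G \<circ> arc_fun\<close>, for continuous \<open>G\<close>, is approximable because \<open>G \<circ> arc_fun\<close> is a uniform limit of
  trigonometric polynomials. The indicator is the limit of such products with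
  \<open>G y = min 1 (max 0 (n y))\<close>, which tends to the indicator of \<open>{y > 0}\<close>.
\<close>

lemma approximable_box_indicator:
  fixes a b c d :: real
  assumes p: "0 < p"
  shows "approximable p (\<lambda>w. of_real (indicator ({a<..<b} \<times> {c<..<d}) w))"
proof -
  let ?I = "indicator {a<..<b} :: real \<Rightarrow> real"
  have Imeas: "(\<lambda>z. ?I (fst z)) \<in> borel_measurable RT"
    by measurable
  have Ifin: "(\<integral>\<^sup>+z. ennreal ((B * ?I (fst z)) powr p) \<partial>RT) < \<infinity>" for B :: real
  proof -
    have "(\<integral>\<^sup>+z. ennreal ((B * ?I (fst z)) powr p) \<partial>RT) = (\<integral>\<^sup>+x. ennreal ((B * ?I x) powr p) \<partial>lborel)"
      by (rule nn_integral_RT_fst[where w="\<lambda>x. ennreal ((B * ?I x) powr p)"]) measurable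
    also have "\<dots> \<le> (\<integral>\<^sup>+x. ennreal (B powr p) * indicator {a<..<b} x \<partial>lborel)"
      using p by (intro nn_integral_mono) (auto simp: indicator_def)
    also have "\<dots> = ennreal (B powr p) * emeasure lborel {a<..<b}"
      by (rule nn_integral_cmult_indicator) auto
    also have "\<dots> < \<infinity>" by (cases "a \<le> b") (auto simp: ennreal_mult_less_top)
    finally show ?thesis .
  qed
  obtain h :: "nat \<Rightarrow> real \<Rightarrow> real" where h: "\<And>n. C0_infinity (\<lambda>x. of_real (h n x))"
    "\<And>n x. 0 \<le> h n x" "\<And>n x. h n x \<le> ?I x" "\<And>x. (\<lambda>n. h n x) \<longlonglongrightarrow> ?I x"
    using C0_infinity_approx_indicator[of a b] by blast
  have prod: "approximable p (\<lambda>w. of_real (h n (fst w)) * of_real (G (arc_fun c' d' (snd w))))"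
    if G: "continuous_on UNIV G" for n and c' d' :: real and G :: "real \<Rightarrow> real"
  proof -
    have G': "continuous_on {-2..2} G" using G by (rule continuous_on_subset) auto
    have "\<forall>k. \<exists>\<tau>\<in>trig_poly. \<forall>\<gamma>. cmod (of_real (G (arc_fun c' d' \<gamma>)) - \<tau> \<gamma>) < inverse (real (Suc k))"
      by (intro allI trig_poly_uniform_approx[OF G']) simp
    then obtain \<tau> where \<tau>: "\<And>k. \<tau> k \<in> trig_poly"
      "\<And>k \<gamma>. cmod (of_real (G (arc_fun c' d' \<gamma>)) - \<tau> k \<gamma>) < inverse (real (Suc k))" by metis
    have "compact (G ` {-2..2})" using G' by (intro compact_continuous_image) auto
    then obtain B where "\<forall>y\<in>{-2..2}. \<bar>G y\<bar> \<le> B"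
      by (auto dest!: compact_imp_bounded simp: bounded_iff)
    then have B: "\<And>y. y \<in> {-2..2} \<Longrightarrow> \<bar>G y\<bar> \<le> B" by blast
    show ?thesis
    proof (rule approximable_dominated[where w="\<lambda>z. (B + 1) * ?I (fst z)" and u="\<lambda>k w. of_real (h n (fst w)) * \<tau> k (snd w)"])
      show "approximable p (\<lambda>w. of_real (h n (fst w)) * \<tau> k (snd w))" for k
        by (intro approximable_smooth_trig smooth_trig_product[of "\<lambda>x. of_real (h n x)"] h \<tau>)
      have "continuous_on UNIV (\<lambda>w::real \<times> real. arc_fun c' d' (snd w))"
        unfolding arc_fun_def by (intro continuous_intros)
      then have "continuous_on UNIV (\<lambda>w::real \<times> real. G (arc_fun c' d' (snd w)))"
        by (rule continuous_on_compose2[OF G]) auto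
      moreover have "continuous_on UNIV (\<lambda>w::real \<times> real. complex_of_real (h n (fst w)))"
        by (rule continuous_on_compose2[OF C0_infinity_continuous[OF h(1)]]) (auto intro: continuous_intros)
      ultimately show "(\<lambda>w. complex_of_real (h n (fst w)) * of_real (G (arc_fun c' d' (snd w)))) \<in> borel_measurable RT"
        by (intro borel_measurable_RT_continuous continuous_on_mult) (auto intro: continuous_on_of_real)
      show "AE z in RT. cmod (of_real (h n (fst z)) * \<tau> k (snd z)) \<le> (B + 1) * ?I (fst z)" for k
      proof (rule AE_I2)
        fix z :: "real \<times> real"
        have "inverse (real (Suc k)) \<le> 1" by (simp add: inverse_le_1_iff)
        then have "cmod (\<tau> k (snd z)) \<le> B + 1"
          using \<tau>(2)[of "snd z" k] B[OF arc_fun_bounds[of c' d' "snd z"]]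
            norm_triangle_ineq2[of "\<tau> k (snd z)" "of_real (G (arc_fun c' d' (snd z)))"]
          by (simp add: norm_minus_commute)
        then have "h n (fst z) * cmod (\<tau> k (snd z)) \<le> ?I (fst z) * (B + 1)"
          using h by (intro mult_mono) auto
        then show "cmod (of_real (h n (fst z)) * \<tau> k (snd z)) \<le> (B + 1) * ?I (fst z)"
          using h(2) by (simp add: norm_mult mult.commute)
      qed
      have "(\<lambda>k. \<tau> k \<gamma>) \<longlonglongrightarrow> of_real (G (arc_fun c' d' \<gamma>))" for \<gamma>
      proof (rule LIM_zero_cancel, rule Lim_null_comparison[OF _ LIMSEQ_inverse_real_of_nat])
        show "\<forall>\<^sub>F k in sequentially. norm (\<tau> k \<gamma> - of_real (G (arc_fun c' d' \<gamma>))) \<le> inverse (real (Suc k))"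
          using \<tau>(2)[of \<gamma>] by (simp add: norm_minus_commute less_imp_le)
      qed
      then show "AE z in RT. (\<lambda>k. of_real (h n (fst z)) * \<tau> k (snd z)) \<longlonglongrightarrow> of_real (h n (fst z)) * of_real (G (arc_fun c' d' (snd z)))"
        by (intro AE_I2 tendsto_intros)
    qed (use p Ifin Imeas in auto)
  qed
  have core: "approximable p (\<lambda>w. of_real (?I (fst w) * indicator {c'<..<d'} (snd w)))"
    if cd: "0 \<le> c'" "c' \<le> d'" "d' \<le> 1" for c' d' :: real
  proof (rule approximable_dominated[where w="\<lambda>z. 1 * ?I (fst z)" and
        u="\<lambda>n w. of_real (h n (fst w)) * of_real (min 1 (max 0 (real n * arc_fun c' d' (snd w))))"])
    show "approximable p (\<lambda>w. of_real (h n (fst w)) * of_real (min 1 (max 0 (real n * arc_fun c' d' (snd w)))))" for n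
      by (rule prod[of "\<lambda>y. min 1 (max 0 (real n * y))"]) (intro continuous_intros)
    show "(\<lambda>w. complex_of_real (?I (fst w) * indicator {c'<..<d'} (snd w))) \<in> borel_measurable RT"
      by measurable
    show "AE z in RT. cmod (of_real (h n (fst z)) * of_real (min 1 (max 0 (real n * arc_fun c' d' (snd z))))) \<le> 1 * ?I (fst z)" for n
    proof (rule AE_I2)
      fix z :: "real \<times> real"
      have "h n (fst z) * \<bar>min 1 (max 0 (real n * arc_fun c' d' (snd z)))\<bar> \<le> ?I (fst z) * 1"
        using h by (intro mult_mono) auto
      then show "cmod (of_real (h n (fst z)) * of_real (min 1 (max 0 (real n * arc_fun c' d' (snd z))))) \<le> 1 * ?I (fst z)"
        using h(2) by (simp add: norm_mult)
    qed
    show "AE z in RT. (\<lambda>n. complex_of_real (h n (fst z)) * of_real (min 1 (max 0 (real n * arc_fun c' d' (snd z)))))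
       \<longlonglongrightarrow> of_real (?I (fst z) * indicator {c'<..<d'} (snd z))"
    proof (rule AE_I2)
      fix z assume "z \<in> space RT"
      then have g: "snd z \<in> {0..<1}" by (auto simp: space_RT)
      let ?y = "arc_fun c' d' (snd z)"
      have "(\<lambda>n. min 1 (max 0 (real n * ?y))) \<longlonglongrightarrow> indicator {c'<..<d'} (snd z)"
      proof (cases "0 < ?y")
        case True
        have "\<forall>\<^sub>F n in sequentially. 1 / ?y \<le> real n"
          using filterlim_real_sequentially by (simp add: filterlim_at_top)
        then have "\<forall>\<^sub>F n in sequentially. min 1 (max 0 (real n * ?y)) = 1"
          by eventually_elim (use True in \<open>simp add: field_simps\<close>)
        then show ?thesis using True arc_fun_pos_iff[OF cd g] by (simp add: tendsto_eventually)
      next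
        case False
        have "real n * ?y \<le> 0" for n using False by (intro mult_nonneg_nonpos) auto
        then have "min 1 (max 0 (real n * ?y)) = 0" for n by (simp add: max_absorb1)
        then show ?thesis using False arc_fun_pos_iff[OF cd g] by simp
      qed
      then show "(\<lambda>n. complex_of_real (h n (fst z)) * of_real (min 1 (max 0 (real n * ?y))))
       \<longlonglongrightarrow> of_real (?I (fst z) * indicator {c'<..<d'} (snd z))"
        unfolding of_real_mult by (intro tendsto_mult tendsto_of_real h)
    qed
  qed (use p Ifin[of 1] Imeas in auto)
  have meas: "(\<lambda>w. complex_of_real (indicator ({a<..<b} \<times> {c<..<d}) w)) \<in> borel_measurable RT"
    by (intro RT_indicator_measurable borel_open open_Times) auto
  \<comment> \<open>Clipping to the fundamental domain changes the indicator at most where the second coordinate is 0.\<close>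
  show ?thesis
  proof (cases "max c 0 \<le> min d 1")
    case True
    show ?thesis
    proof (rule approximable_cong_AE[OF core[OF _ True] _ meas])
      show "AE w in RT. complex_of_real (?I (fst w) * indicator {max c 0<..<min d 1} (snd w))
           = of_real (indicator ({a<..<b} \<times> {c<..<d}) w)"
        using AE_RT_snd_nonzero AE_space
        by eventually_elim (auto simp: space_RT indicator_def split: prod.splits)
    qed auto
  next
    case False
    show ?thesis
      by (rule approximable_cong_AE[OF approximable_zero _ meas], rule AE_I2)
         (use False in \<open>auto simp: space_RT indicator_def\<close>)
  qed
qed


text \<open>
  A Dynkin argument with the boxes as generator. Cutting down to the bounded box \<open>(-n, n) \<times> (-2, 2)\<close> provides an
  integrable bound for countable unions; its second factor contains the fundamental
  domain, so that nothing is cut off in the second variable.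
\<close>

lemma approximable_indicator:
  fixes A :: "(real \<times> real) set"
  assumes p: "0 < p" and A: "A \<in> sets borel"
  shows "approximable p (\<lambda>w. of_real (indicator (A \<inter> ({- real n<..<real n} \<times> {-2<..<2})) w))"
proof -
  let ?K = "{- real n<..<real n} \<times> {-2<..<2::real}"
  have K: "?K \<in> sets borel" by (intro borel_open open_Times) auto
  have Kfin: "(\<integral>\<^sup>+z. ennreal (indicator ?K z powr p) \<partial>RT) < \<infinity>"
  proof -
    have "(\<integral>\<^sup>+z. ennreal (indicator ?K z powr p) \<partial>RT) \<le> (\<integral>\<^sup>+z. indicator {- real n<..<real n} (fst z) \<partial>RT)"
      using p by (intro nn_integral_mono) (auto simp: indicator_def)
    also have "\<dots> = (\<integral>\<^sup>+x. indicator {- real n<..<real n} x \<partial>lborel)"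
      by (rule nn_integral_RT_fst) measurable
    also have "\<dots> < \<infinity>" by simp
    finally show ?thesis .
  qed
  have meas: "(\<lambda>w. complex_of_real (indicator (A \<inter> ?K) w)) \<in> borel_measurable RT" if "A \<in> sets borel" for A
    using that K by (intro RT_indicator_measurable sets.Int)
  have box: "box u v = {fst u<..<fst v} \<times> {snd u<..<snd v}" for u v :: "real \<times> real"
    by (cases u; cases v) (auto simp: box_def Basis_prod_def)
  have int: "({a<..<b} \<times> {c<..<d}) \<inter> ({a'<..<b'} \<times> {c'<..<d'}) = {max a a'<..<min b b'} \<times> {max c c'<..<min d d'}"
    for a b c d a' b' c' d' :: real by auto
  have "Int_stable (range (\<lambda>(u, v). box u v :: (real \<times> real) set))"
    by (auto simp: Int_stable_def box_Int_box)
  moreover have "range (\<lambda>(u, v). box u v :: (real \<times> real) set) \<subseteq> Pow UNIV" by simp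
  moreover have "A \<in> sigma_sets UNIV (range (\<lambda>(u, v). box u v))"
    using A by (simp add: borel_eq_box)
  ultimately show ?thesis
  proof (induction A rule: sigma_sets_induct_disjoint)
    case (basic A)
    then show ?case by (auto simp: box int intro!: approximable_box_indicator p)
  next
    case empty
    show ?case by (simp add: approximable_zero)
  next
    case (compl A)
    have "approximable p (\<lambda>w. of_real (indicator ?K w) + (-1) * of_real (indicator (A \<inter> ?K) w))"
      by (intro approximable_add approximable_scale approximable_box_indicator p compl)
    moreover have "complex_of_real (indicator ?K w) + (-1) * of_real (indicator (A \<inter> ?K) w) = of_real (indicator ((UNIV - A) \<inter> ?K) w)" for w
      by (auto simp: indicator_def)
    ultimately show ?case by simp
  next
    case (union A)
    have Am: "A i \<in> sets borel" for i using union(2) by (auto simp: borel_eq_box)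
    show ?case
    proof (rule approximable_dominated[where u="\<lambda>m w. \<Sum>i<m. of_real (indicator (A i \<inter> ?K) w)" and w="indicator ?K"])
      have eq: "(\<Sum>i<m. complex_of_real (indicator (A i \<inter> ?K) w)) = of_real (indicator ((\<Union>i<m. A i) \<inter> ?K) w)" for m w
      proof -
        have "(\<Sum>i<m. indicator (A i \<inter> ?K) w :: real) = indicator (\<Union>i<m. A i \<inter> ?K) w"
          using union(1) by (intro indicator_UN_disjoint[symmetric]) (auto simp: disjoint_family_on_def)
        also have "(\<Union>i<m. A i \<inter> ?K) = (\<Union>i<m. A i) \<inter> ?K" by blast
        finally show ?thesis by (simp flip: of_real_sum)
      qed
      show "approximable p (\<lambda>w. \<Sum>i<m. of_real (indicator (A i \<inter> ?K) w))" for m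
        by (intro approximable_sum p union)
      show "AE z in RT. cmod (\<Sum>i<m. of_real (indicator (A i \<inter> ?K) z)) \<le> indicator ?K z" for m
        unfolding eq by (rule AE_I2) (auto simp: indicator_def)
      show "AE z in RT. (\<lambda>m. \<Sum>i<m. complex_of_real (indicator (A i \<inter> ?K) z)) \<longlonglongrightarrow> of_real (indicator ((\<Union>i. A i) \<inter> ?K) z)"
        unfolding eq
      proof (rule AE_I2)
        fix z :: "real \<times> real"
        show "(\<lambda>m. complex_of_real (indicator ((\<Union>i<m. A i) \<inter> ?K) z)) \<longlonglongrightarrow> of_real (indicator ((\<Union>i. A i) \<inter> ?K) z)"
        proof (cases "z \<in> (\<Union>i. A i)")
          case True
          then obtain i where i: "z \<in> A i" by blast
          have "\<forall>\<^sub>F m in sequentially. complex_of_real (indicator ((\<Union>i<m. A i) \<inter> ?K) z) = of_real (indicator ((\<Union>i. A i) \<inter> ?K) z)"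
            using eventually_gt_at_top[of i] by eventually_elim (use i in \<open>auto simp: indicator_def\<close>)
          then show ?thesis by (rule tendsto_eventually)
        next
          case False
          then show ?thesis by (auto simp: indicator_def)
        qed
      qed
      show "indicator ?K \<in> borel_measurable RT"
        by (intro borel_measurable_RT borel_measurable_indicator K)
    qed (use p Kfin meas[of "\<Union>i. A i"] Am in auto)
  qed
qed

text \<open>
  Approximating simple functions that are bounded by \<open>2 \<bar>f\<bar>\<close>, cut off to growing boxes, converge
  to \<open>f\<close> in norm by dominated convergence.
\<close>

lemma RT_Lp_approximable:
  assumes p: "0 < p" and f: "f \<in> borel_measurable RT" "RT_norm_pow p f < \<infinity>"
  shows "approximable p f"
proof -
  obtain s where s: "\<And>i. simple_function RT (s i)" "\<And>x. x \<in> space RT \<Longrightarrow> (\<lambda>i. s i x) \<longlonglongrightarrow> f x"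
    "\<And>i x. x \<in> space RT \<Longrightarrow> cmod (s i x) \<le> 2 * cmod (f x)"
    using borel_measurable_implies_sequence_metric[OF f(1), of 0] by (simp add: dist_norm) metis
  let ?K = "\<lambda>n::nat. {- real n<..<real n} \<times> {-2<..<2::real}"
  show ?thesis
  proof (rule approximable_dominated[where u="\<lambda>n w. s n w * of_real (indicator (?K n) w)" and w="\<lambda>w. 2 * cmod (f w)"])
    fix n
    have sm: "s n \<in> borel_measurable RT" using s(1) by (rule borel_measurable_simple_function)
    have Km: "(\<lambda>w. complex_of_real (indicator (?K n) w)) \<in> borel_measurable RT"
      by (intro RT_indicator_measurable borel_open open_Times) auto
    have fin: "finite (s n ` space RT)" using s(1) by (simp add: simple_function_def)
    have "approximable p (\<lambda>w. \<Sum>y\<in>s n ` space RT. y * of_real (indicator ((s n -` {y} \<inter> space RT) \<inter> ?K n) w))"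
      using sm by (intro approximable_sum approximable_scale approximable_indicator p sets_RT_subset_borel) (auto intro: measurable_sets)
    then show "approximable p (\<lambda>w. s n w * of_real (indicator (?K n) w))"
    proof (rule approximable_cong_AE)
      show "AE w in RT. (\<Sum>y\<in>s n ` space RT. y * of_real (indicator ((s n -` {y} \<inter> space RT) \<inter> ?K n) w)) = s n w * of_real (indicator (?K n) w)"
      proof (rule AE_I2)
        fix w assume w: "w \<in> space RT"
        have "(\<Sum>y\<in>s n ` space RT. y * of_real (indicator ((s n -` {y} \<inter> space RT) \<inter> ?K n) w))
           = (\<Sum>y\<in>s n ` space RT. if y = s n w then s n w * of_real (indicator (?K n) w) else 0)"
          using w by (intro sum.cong) (auto simp: indicator_def)
        also have "\<dots> = s n w * of_real (indicator (?K n) w)"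
          using fin w by (subst sum.delta) auto
        finally show "(\<Sum>y\<in>s n ` space RT. y * of_real (indicator ((s n -` {y} \<inter> space RT) \<inter> ?K n) w)) = s n w * of_real (indicator (?K n) w)" .
      qed
      show "(\<lambda>w. s n w * of_real (indicator (?K n) w)) \<in> borel_measurable RT"
        using sm Km by (rule borel_measurable_times)
    qed
    show "AE z in RT. cmod (s n z * of_real (indicator (?K n) z)) \<le> 2 * cmod (f z)"
      using s(3) by (intro AE_I2) (auto simp: norm_mult indicator_def)
  next
    have "(\<integral>\<^sup>+z. ennreal ((2 * cmod (f z)) powr p) \<partial>RT) = ennreal (2 powr p) * RT_norm_pow p f"
      unfolding RT_norm_pow_def using f(1)
      by (subst nn_integral_cmult[symmetric]) (auto simp: powr_mult ennreal_mult)
    then show "(\<integral>\<^sup>+z. ennreal ((2 * cmod (f z)) powr p) \<partial>RT) < \<infinity>"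
      using f(2) by (simp add: ennreal_mult_less_top)
    show "AE z in RT. (\<lambda>n. s n z * of_real (indicator (?K n) z)) \<longlonglongrightarrow> f z"
    proof (rule AE_I2)
      fix z assume z: "z \<in> space RT"
      have "\<forall>\<^sub>F n in sequentially. \<bar>fst z\<bar> < real n"
        using filterlim_real_sequentially by (auto simp: filterlim_at_top_dense)
      then have "\<forall>\<^sub>F n in sequentially. complex_of_real (indicator (?K n) z) = 1"
        by eventually_elim (use z in \<open>auto simp: space_RT indicator_def\<close>)
      then have "(\<lambda>n. complex_of_real (indicator (?K n) z)) \<longlonglongrightarrow> 1" by (rule tendsto_eventually)
      from tendsto_mult[OF s(2)[OF z] this] show "(\<lambda>n. s n z * of_real (indicator (?K n) z)) \<longlonglongrightarrow> f z" by simp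
    qed
  qed (use p f in auto)
qed

text \<open>
  The normal form that \<open>dense_class\<close> prescribes, with the degree bound \<open>N\<close> as a parameter so that it
  can be made the same for all four boundary components.
\<close>

definition trig_expansion :: "nat \<Rightarrow> (real \<Rightarrow> int \<Rightarrow> complex) \<Rightarrow> (real \<times> real \<Rightarrow> complex) \<Rightarrow> bool" where
  "trig_expansion N c f \<longleftrightarrow> (\<forall>j. C0_infinity (\<lambda>x. c x j)) \<and>
     (\<forall>x \<gamma>. f (x, \<gamma>) = (\<Sum>j | \<bar>j\<bar> < int N. c x j * cis (2 * pi * of_int j * \<gamma>)))"

lemma finite_int_abs_less: "finite {j::int. \<bar>j\<bar> < int N}"
proof -
  have "{j::int. \<bar>j\<bar> < int N} = {- int N<..<int N}" by auto
  then show ?thesis by simp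
qed

lemma trig_expansion_pad:
  assumes "trig_expansion N c f" "N \<le> M"
  shows "trig_expansion M (\<lambda>x j. if \<bar>j\<bar> < int N then c x j else 0) f"
  unfolding trig_expansion_def
proof (intro conjI allI)
  fix j :: int
  show "C0_infinity (\<lambda>x. if \<bar>j\<bar> < int N then c x j else 0)"
    using assms(1) by (cases "\<bar>j\<bar> < int N") (auto simp: trig_expansion_def C0_infinity_zero)
next
  fix x \<gamma> :: real
  show "f (x, \<gamma>) = (\<Sum>j | \<bar>j\<bar> < int M. (if \<bar>j\<bar> < int N then c x j else 0) * cis (2 * pi * of_int j * \<gamma>))"
    using assms by (subst sum.mono_neutral_cong_right[OF finite_int_abs_less, of "{j. \<bar>j\<bar> < int N}"])
      (auto simp: trig_expansion_def)
qed

lemma smooth_trig_expansion: "f \<in> smooth_trig \<Longrightarrow> \<exists>N c. trig_expansion N c f"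
proof (induction rule: smooth_trig.induct)
  case (monomial h j)
  have "trig_expansion (Suc (nat \<bar>j\<bar>)) (\<lambda>x k. if k = j then h x else 0) (\<lambda>w. h (fst w) * cis (2 * pi * of_int j * snd w))"
    unfolding trig_expansion_def
  proof (intro conjI allI)
    show "C0_infinity (\<lambda>x. if k = j then h x else 0)" for k
      using monomial by (cases "k = j") (auto simp: C0_infinity_zero)
    fix x \<gamma> :: real
    have "(\<Sum>k | \<bar>k\<bar> < int (Suc (nat \<bar>j\<bar>)). (if k = j then h x else 0) * cis (2 * pi * of_int k * \<gamma>))
       = (\<Sum>k | \<bar>k\<bar> < int (Suc (nat \<bar>j\<bar>)). if k = j then h x * cis (2 * pi * of_int k * \<gamma>) else 0)"
      by (intro sum.cong) auto
    also have "\<dots> = h x * cis (2 * pi * of_int j * \<gamma>)"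
      by (subst sum.delta[OF finite_int_abs_less]) auto
    finally show "h (fst (x, \<gamma>)) * cis (2 * pi * of_int j * snd (x, \<gamma>)) =
      (\<Sum>k | \<bar>k\<bar> < int (Suc (nat \<bar>j\<bar>)). (if k = j then h x else 0) * cis (2 * pi * of_int k * \<gamma>))" by simp
  qed
  then show ?case by blast
next
  case (add f g)
  then obtain N c M d where "trig_expansion N c f" "trig_expansion M d g" by blast
  then obtain c' d' where "trig_expansion (max N M) c' f" "trig_expansion (max N M) d' g"
    using trig_expansion_pad max.cobounded1 max.cobounded2 by metis
  then have "trig_expansion (max N M) (\<lambda>x j. c' x j + d' x j) (\<lambda>w. f w + g w)"
    by (auto simp: trig_expansion_def C0_infinity_add distrib_right sum.distrib)
  then show ?case by blast
qed

lemma dense_class_dense: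
  fixes \<phi> :: "nat \<Rightarrow> real \<times> real \<Rightarrow> complex"
  assumes "0 < p" "0 < e"
    and \<phi>: "\<And>l. l \<in> {1..4} \<Longrightarrow> \<phi> l \<in> borel_measurable RT" "\<And>l. l \<in> {1..4} \<Longrightarrow> RT_norm_pow p (\<phi> l) < \<infinity>"
  shows "\<exists>\<psi>\<in>dense_class. \<forall>l\<in>{1..4}. \<psi> l \<in> borel_measurable RT \<and> RT_norm_pow p (\<lambda>w. \<phi> l w - \<psi> l w) < ennreal e"
proof -
  have "\<exists>g\<in>smooth_trig. RT_norm_pow p (\<lambda>w. \<phi> l w - g w) < ennreal e" if "l \<in> {1..4}" for l
    using RT_Lp_approximable[OF assms(1) \<phi>[OF that]] \<open>0 < e\<close> unfolding approximable_def by blast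
  then obtain \<psi> where \<psi>: "\<And>l. l \<in> {1..4} \<Longrightarrow> \<psi> l \<in> smooth_trig"
    "\<And>l. l \<in> {1..4} \<Longrightarrow> RT_norm_pow p (\<lambda>w. \<phi> l w - \<psi> l w) < ennreal e" by metis
  obtain N c where Nc: "\<And>l. l \<in> {1..4} \<Longrightarrow> trig_expansion (N l) (c l) (\<psi> l)"
    using smooth_trig_expansion[OF \<psi>(1)] by metis
  define M where "M = Max (N ` {1..4})"
  have "\<exists>d. trig_expansion M d (\<psi> l)" if l: "l \<in> {1..4}" for l
  proof -
    have "N l \<le> M" unfolding M_def using l by (intro Max_ge) auto
    from trig_expansion_pad[OF Nc[OF l] this] show ?thesis by blast
  qed
  then obtain d where "\<And>l. l \<in> {1..4} \<Longrightarrow> trig_expansion M (d l) (\<psi> l)" by metis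
  then have "\<psi> \<in> dense_class"
    unfolding dense_class_def trig_expansion_def by blast
  then show ?thesis using \<psi> smooth_trig_measurable by blast
qed

section \<open>The operator on the dense class\<close>

lemma set_integral_cis_period:
  fixes m :: int
  shows "(LINT \<gamma>:{0..<1}|lborel. cis (2 * pi * of_int m * \<gamma>)) = (if m = 0 then 1 else 0)"
proof (cases "m = 0")
  case True
  have "(LINT \<gamma>:{0..<1::real}|lborel. (1::complex)) = 1"
    by (simp add: set_lebesgue_integral_def)
  then show ?thesis using True by simp
next
  case False
  define c where "c = 2 * pi * real_of_int m"
  have c: "c \<noteq> 0" using False by (simp add: c_def)
  have "(LBINT \<gamma>=ereal 0..ereal 1. cis (c * \<gamma>)) = cis (c * 1) / (\<i> * of_real c) - cis (c * 0) / (\<i> * of_real c)"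
  proof (rule interval_integral_FTC_finite)
    show "continuous_on {min 0 1..max 0 1} (\<lambda>\<gamma>. cis (c * \<gamma>))" by (intro continuous_intros)
    show "((\<lambda>\<gamma>. cis (c * \<gamma>) / (\<i> * of_real c)) has_vector_derivative cis (c * \<gamma>)) (at \<gamma> within {min 0 1..max 0 1})" for \<gamma>
      using has_vector_derivative_mult_right[OF has_vector_derivative_cis_linear[of c \<gamma>], of "1 / (\<i> * of_real c)"] c
      by (auto intro!: has_vector_derivative_at_within)
  qed
  moreover have "cis (c * 1) = 1"
    unfolding c_def using cis_multiple_2pi[of "of_int m"] by (simp add: mult_ac)
  ultimately have "(LBINT \<gamma>=ereal 0..ereal 1. cis (c * \<gamma>)) = 0" by simp
  then show ?thesis using False by (subst (asm) interval_integral_Ico) (auto simp: c_def)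
qed

lemma fourier_coeff_trig_sum:
  assumes "\<And>\<gamma>. \<psi> (x, \<gamma>) = (\<Sum>k | \<bar>k\<bar> < int N. a k * cis (2 * pi * of_int k * \<gamma>))"
  shows "fourier_coeff \<psi> j x = (if \<bar>j\<bar> < int N then a j else 0)"
proof -
  have int: "set_integrable lborel {0..<1::real} (\<lambda>\<gamma>. cis (2 * pi * of_int k * \<gamma>))" for k :: int
  proof (rule set_integrable_subset)
    show "set_integrable lborel {0..1::real} (\<lambda>\<gamma>. cis (2 * pi * of_int k * \<gamma>))"
      by (intro borel_integrable_atLeastAtMost' continuous_intros)
  qed auto
  have int': "set_integrable lborel {0..<1::real} (\<lambda>\<gamma>. a k * cis (2 * pi * of_int l * \<gamma>))" for k l
    by (intro set_integrable_mult_right int)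
  have shift: "a k * cis (2 * pi * of_int k * \<gamma>) * cis (- 2 * pi * of_int j * \<gamma>) = a k * cis (2 * pi * of_int (k - j) * \<gamma>)" for k \<gamma>
    by (simp add: mult.assoc cis_mult algebra_simps)
  have "fourier_coeff \<psi> j x = (LINT \<gamma>:{0..<1}|lborel. \<Sum>k | \<bar>k\<bar> < int N. a k * cis (2 * pi * of_int (k - j) * \<gamma>))"
    unfolding fourier_coeff_def assms sum_distrib_right shift ..
  also have "\<dots> = (\<Sum>k | \<bar>k\<bar> < int N. (LINT \<gamma>:{0..<1}|lborel. a k * cis (2 * pi * of_int (k - j) * \<gamma>)))"
    unfolding set_lebesgue_integral_def scaleR_sum_right
    by (intro Bochner_Integration.integral_sum int'[unfolded set_integrable_def])
  also have "\<dots> = (\<Sum>k | \<bar>k\<bar> < int N. if k = j then a k else 0)"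
    by (intro sum.cong refl) (simp add: set_integral_cis_period set_integral_cis_period[of 0, simplified] del: of_int_diff)
  also have "\<dots> = (if \<bar>j\<bar> < int N then a j else 0)"
    by (subst sum.delta[OF finite_int_abs_less]) auto
  finally show ?thesis .
qed

text \<open>
  The Fourier coefficients of \<open>\<psi>\<close> of order \<open>N\<close> and higher vanish, and the radius \<open>r = exp (s / 2)\<close> is
  that of a slice. Nothing here confines \<open>v\<close> and \<open>s\<close> to the interior of their range, so the boundary
  value is covered as well.
\<close>

lemma S_dense_eq_finite_sum:
  assumes coeff: "\<forall>m\<in>{1..4}. \<forall>j. fourier_coeff (\<psi> m) j = (\<lambda>x. if \<bar>j\<bar> < int N then c m x j else 0)"
  shows "S_dense \<beta> \<psi> u v (exp (s / 2)) \<gamma> = 1 / 4 * (\<Sum>m\<in>{1..4}. \<Sum>j | \<bar>j\<bar> < int N.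
     of_real (exp (of_int j * (s / 2)) * exp (of_int j * sigma m / 2 * (\<beta> - pi / 2))) * cis (2 * pi * of_int j * \<gamma>)
     * strip_term (2 * \<beta> - pi) (of_int j / 2) (\<lambda>x. c m x j) (v + eta \<beta> m) u)"
  unfolding S_dense_def
proof (intro arg_cong[of _ _ "\<lambda>x. 1 / 4 * x"] sum.cong refl)
  fix m :: nat assume m: "m \<in> {1..4}"
  note coeff_m = coeff[rule_format, OF m]
  let ?t = "\<lambda>j. complex_of_real (exp (s / 2) powi j * exp (of_int j * sigma m / 2 * (\<beta> - pi / 2)))
     * cis (2 * pi * of_int j * \<gamma>)
     * inv_fourier (\<lambda>\<xi>. complex_of_real (exp (- (v + eta \<beta> m) * \<xi>))
           * fourier (fourier_coeff (\<psi> m) j) \<xi>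
           / complex_of_real (cosh (pi * \<xi>) * cosh ((2 * \<beta> - pi) * (\<xi> - of_int j / 2)))) u"
  let ?r = "\<lambda>j. of_real (exp (of_int j * (s / 2)) * exp (of_int j * sigma m / 2 * (\<beta> - pi / 2))) * cis (2 * pi * of_int j * \<gamma>)
     * strip_term (2 * \<beta> - pi) (of_int j / 2) (\<lambda>x. c m x j) (v + eta \<beta> m) u"
  have in_range: "?t j = ?r j" if "\<bar>j\<bar> < int N" for j :: int
    using that unfolding strip_term_def strip_multiplier_def coeff_m
    by (simp add: exp_power_int)
  have out_range: "?t j = 0" if "\<not> \<bar>j\<bar> < int N" for j :: int
    using that unfolding coeff_m by (simp add: fourier_def inv_fourier_def)
  have "infsum ?t UNIV = infsum ?r {j. \<bar>j\<bar> < int N}"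
    by (rule infsum_cong_neutral) (use in_range out_range in auto)
  then show "infsum ?t UNIV = sum ?r {j. \<bar>j\<bar> < int N}"
    by (simp only: infsum_finite[OF finite_int_abs_less])
qed

text \<open>
  The boundary formula is the interior formula at \<open>v = \<beta>\<close> and \<open>s = \<beta> - \<pi> / 2\<close>.
\<close>

lemma S1_dense_eq_S_dense: "S1_dense \<beta> \<psi> x \<gamma> = S_dense \<beta> \<psi> x \<beta> (exp ((\<beta> - pi / 2) / 2)) \<gamma>"
proof -
  have "exp (of_int j * (1 + sigma m) / 2 * (\<beta> - pi / 2)) =
     exp ((\<beta> - pi / 2) / 2) powi j * exp (of_int j * sigma m / 2 * (\<beta> - pi / 2))" for j :: int and m
    by (simp add: exp_power_int flip: exp_add) (simp add: field_simps)
  then show ?thesis unfolding S1_dense_def S_dense_def by simp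
qed

text \<open>
  The bound \<open>2 \<beta>\<close> is attained for \<open>m = 1\<close> at \<open>v = \<beta>\<close>; it is written as \<open>\<pi> + \<kappa>\<close>, which is what the
  multiplier tolerates.
\<close>

lemma eta_bound:
  assumes "pi / 2 < \<beta>" "v \<in> {0..\<beta>}"
  shows "\<bar>v + eta \<beta> m\<bar> \<le> pi + (2 * \<beta> - pi)"
proof -
  define P where "P = pi"
  have "0 < P" by (simp add: P_def)
  then show ?thesis
    using assms unfolding eta_def P_def[symmetric] by (auto simp: abs_le_iff)
qed

lemma dense_class_expansion:
  assumes "\<psi> \<in> dense_class"
  obtains N c where "\<And>m j. m \<in> {1..4} \<Longrightarrow> C0_infinity (\<lambda>x. c m x j)"
    "\<forall>m\<in>{1..4}. \<forall>j. fourier_coeff (\<psi> m) j = (\<lambda>x. if \<bar>j\<bar> < int N then c m x j else 0)"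
proof -
  obtain N c where c: "\<forall>l\<in>{1..4}. (\<forall>j. C0_infinity (\<lambda>x. c l x j)) \<and>
      (\<forall>x \<gamma>. \<psi> l (x, \<gamma>) = (\<Sum>j | \<bar>j\<bar> < int N. c l x j * cis (2 * pi * of_int j * \<gamma>)))"
    using assms unfolding dense_class_def by blast
  show thesis
  proof (rule that[of c N])
    show "C0_infinity (\<lambda>x. c m x j)" if "m \<in> {1..4}" for m j using c that by blast
    show "\<forall>m\<in>{1..4}. \<forall>j. fourier_coeff (\<psi> m) j = (\<lambda>x. if \<bar>j\<bar> < int N then c m x j else 0)"
      using c by (intro ballI allI ext fourier_coeff_trig_sum) blast
  qed
qed

lemma S_dense_decay:
  assumes \<beta>: "pi / 2 < \<beta>" and "\<psi> \<in> dense_class"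
  shows "\<exists>C. \<forall>u v s \<gamma>. v \<in> {0..\<beta>} \<longrightarrow> s \<in> {0..\<beta> - pi / 2} \<longrightarrow>
           (1 + \<bar>u\<bar>) * cmod (S_dense \<beta> \<psi> u v (exp (s / 2)) \<gamma>) \<le> C"
proof -
  obtain N c where c: "\<And>m j. m \<in> {1..4} \<Longrightarrow> C0_infinity (\<lambda>x. c m x j)"
    "\<forall>m\<in>{1..4}. \<forall>j. fourier_coeff (\<psi> m) j = (\<lambda>x. if \<bar>j\<bar> < int N then c m x j else 0)"
    using dense_class_expansion[OF assms(2)] by metis
  let ?\<kappa> = "2 * \<beta> - pi"
  have "\<exists>C. \<forall>a u. \<bar>a\<bar> \<le> pi + ?\<kappa> \<longrightarrow> (1 + \<bar>u\<bar>) * cmod (strip_term ?\<kappa> (of_int j / 2) (\<lambda>x. c m x j) a u) \<le> C"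
    if "m \<in> {1..4}" for m j
    using \<beta> by (intro strip_term_decay c that) auto
  then obtain C where C: "\<And>m j a u. m \<in> {1..4} \<Longrightarrow> \<bar>a\<bar> \<le> pi + ?\<kappa> \<Longrightarrow>
      (1 + \<bar>u\<bar>) * cmod (strip_term ?\<kappa> (of_int j / 2) (\<lambda>x. c m x j) a u) \<le> C m j" by metis
  let ?W = "\<lambda>m j. exp (\<bar>of_int j\<bar> * \<beta>) * exp (of_int j * sigma m / 2 * (\<beta> - pi / 2))"
  have "(1 + \<bar>u\<bar>) * cmod (S_dense \<beta> \<psi> u v (exp (s / 2)) \<gamma>) \<le> 1 / 4 * (\<Sum>m\<in>{1..4}. \<Sum>j | \<bar>j\<bar> < int N. ?W m j * C m j)"
    if v: "v \<in> {0..\<beta>}" and s: "s \<in> {0..\<beta> - pi / 2}" for u v s \<gamma>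
  proof -
    let ?T = "\<lambda>m j. of_real (exp (of_int j * (s / 2)) * exp (of_int j * sigma m / 2 * (\<beta> - pi / 2))) * cis (2 * pi * of_int j * \<gamma>)
     * strip_term ?\<kappa> (of_int j / 2) (\<lambda>x. c m x j) (v + eta \<beta> m) u"
    have T: "(1 + \<bar>u\<bar>) * cmod (?T m j) \<le> ?W m j * C m j" if m: "m \<in> {1..4}" for m j
    proof -
      have "0 \<le> s" "s / 2 \<le> \<beta>" using s \<beta> pi_gt_zero unfolding atLeastAtMost_iff by linarith+
      then have "of_int j * (s / 2) \<le> \<bar>of_int j\<bar> * \<beta>"
        by (intro mult_mono) auto
      then have "exp (of_int j * (s / 2)) * exp (of_int j * sigma m / 2 * (\<beta> - pi / 2)) \<le> ?W m j"
        by (intro mult_right_mono) auto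
      then have "(exp (of_int j * (s / 2)) * exp (of_int j * sigma m / 2 * (\<beta> - pi / 2))) *
         ((1 + \<bar>u\<bar>) * cmod (strip_term ?\<kappa> (of_int j / 2) (\<lambda>x. c m x j) (v + eta \<beta> m) u)) \<le> ?W m j * C m j"
        by (intro mult_mono C[OF m eta_bound[OF \<beta> v]]) auto
      then show ?thesis by (simp add: norm_mult mult_ac)
    qed
    have "cmod (S_dense \<beta> \<psi> u v (exp (s / 2)) \<gamma>) \<le> 1 / 4 * (\<Sum>m\<in>{1..4}. \<Sum>j | \<bar>j\<bar> < int N. cmod (?T m j))"
    proof -
      have quarter: "cmod (1 / 4 * z) = 1 / 4 * cmod z" for z :: complex by (simp add: norm_mult)
      show ?thesis
        unfolding S_dense_eq_finite_sum[OF c(2)] quarter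
        by (rule mult_left_mono[OF order_trans[OF norm_sum sum_mono[OF norm_sum]]]) simp
    qed
    then have "(1 + \<bar>u\<bar>) * cmod (S_dense \<beta> \<psi> u v (exp (s / 2)) \<gamma>)
        \<le> (1 + \<bar>u\<bar>) * (1 / 4 * (\<Sum>m\<in>{1..4}. \<Sum>j | \<bar>j\<bar> < int N. cmod (?T m j)))"
      by (rule mult_left_mono) auto
    also have "\<dots> = 1 / 4 * (\<Sum>m\<in>{1..4}. \<Sum>j | \<bar>j\<bar> < int N. (1 + \<bar>u\<bar>) * cmod (?T m j))"
      by (simp only: sum_distrib_left mult.left_commute)
    also have "\<dots> \<le> 1 / 4 * (\<Sum>m\<in>{1..4}. \<Sum>j | \<bar>j\<bar> < int N. ?W m j * C m j)"
      by (intro mult_left_mono sum_mono T) auto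
    finally show ?thesis .
  qed
  then show ?thesis by blast
qed

lemma S_dense_tendsto:
  assumes \<beta>: "pi / 2 < \<beta>" and "\<psi> \<in> dense_class"
    and v: "\<And>n. v n \<in> {0..\<beta>}" "v \<longlonglongrightarrow> v0" and s: "s \<longlonglongrightarrow> s0"
  shows "(\<lambda>n. S_dense \<beta> \<psi> u (v n) (exp (s n / 2)) \<gamma>) \<longlonglongrightarrow> S_dense \<beta> \<psi> u v0 (exp (s0 / 2)) \<gamma>"
proof -
  obtain N c where c: "\<And>m j. m \<in> {1..4} \<Longrightarrow> C0_infinity (\<lambda>x. c m x j)"
    "\<forall>m\<in>{1..4}. \<forall>j. fourier_coeff (\<psi> m) j = (\<lambda>x. if \<bar>j\<bar> < int N then c m x j else 0)"
    using dense_class_expansion[OF assms(2)] by metis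
  have st: "(\<lambda>n. strip_term (2 * \<beta> - pi) b (\<lambda>x. c m x j) (v n + eta \<beta> m) u) \<longlonglongrightarrow>
      strip_term (2 * \<beta> - pi) b (\<lambda>x. c m x j) (v0 + eta \<beta> m) u" if "m \<in> {1..4}" for m j b
    using \<beta> by (intro strip_term_tendsto c that eta_bound v tendsto_intros) auto
  show ?thesis
    unfolding S_dense_eq_finite_sum[OF c(2)] by (intro tendsto_intros s st) auto
qed

section \<open>Slices and passage to the limit\<close>

lemma slice_eq:
  "slice F v s w = F (Complex (fst w) v, complex_of_real (exp (s / 2)) * cis (2 * pi * snd w))"
  by (simp add: slice_def split_beta)

lemma slice_in_Dprime:
  assumes "t \<in> {0..<pi / 2}" "s \<in> {0..<\<beta> - pi / 2}"
  shows "(Complex x (s + t), complex_of_real (exp (s / 2)) * cis \<theta>) \<in> Dprime \<beta>"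
proof -
  have "(cmod (complex_of_real (exp (s / 2)) * cis \<theta>))\<^sup>2 = exp s"
    by (simp add: norm_mult power2_eq_square flip: exp_add)
  then show ?thesis using assms by (simp add: Dprime_def)
qed

lemma slice_measurable:
  assumes "F \<in> Hp p \<beta>" "t \<in> {0..<pi / 2}" "s \<in> {0..<\<beta> - pi / 2}"
  shows "slice F (s + t) s \<in> borel_measurable RT"
proof -
  have "continuous_on (Dprime \<beta>) F"
    unfolding continuous_on_eq_continuous_within
    using assms(1) by (auto simp: Hp_def holomorphic2_on_def dest!: bspec intro: has_derivative_continuous)
  moreover have "continuous_on UNIV (\<lambda>w::real \<times> real. (Complex (fst w) (s + t), complex_of_real (exp (s / 2)) * cis (2 * pi * snd w)))"
    unfolding Complex_eq by (intro continuous_intros)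
  ultimately have "continuous_on UNIV (slice F (s + t) s)"
    unfolding slice_eq[abs_def]
    by (rule continuous_on_compose2) (use slice_in_Dprime[OF assms(2,3)] in auto)
  then show ?thesis by (rule borel_measurable_RT_continuous)
qed

text \<open>
  Operator bounds are stated for norms; this turns them into bounds for \<open>p\<close>-th powers. The maximum
  with \<open>0\<close> accounts for \<open>ennreal C = 0\<close> when \<open>C\<close> is negative.
\<close>

lemma root_ennreal_le_imp:
  assumes p: "0 < p" and le: "root_ennreal p X \<le> ennreal C * root_ennreal p Y" and Y: "Y < \<infinity>"
  shows "X \<le> ennreal (max C 0 powr p) * Y"
proof -
  obtain y where y: "Y = ennreal y" "0 \<le> y" using Y by (cases Y) auto
  have rY: "root_ennreal p Y = ennreal (y powr (1 / p))" using y by (simp add: root_ennreal_def)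
  have C: "ennreal C = ennreal (max C 0)" by (cases "0 \<le> C") (auto simp: ennreal_neg)
  have "X \<noteq> \<infinity>"
    using le[unfolded rY] by (auto simp: root_ennreal_def ennreal_mult_eq_top_iff top_unique)
  then obtain x where x: "X = ennreal x" "0 \<le> x" by (cases X) auto
  have "ennreal (x powr (1 / p)) \<le> ennreal (max C 0 * y powr (1 / p))"
    using le x unfolding rY C by (simp add: root_ennreal_def ennreal_mult)
  then have "x powr (1 / p) \<le> max C 0 * y powr (1 / p)"
    by (simp add: ennreal_le_iff)
  then have "(x powr (1 / p)) powr p \<le> (max C 0 * y powr (1 / p)) powr p"
    using p by (intro powr_mono2) auto
  then have "x \<le> max C 0 powr p * y"
    using p x y by (simp add: powr_mult powr_powr)
  then show ?thesis using x y by (simp add: ennreal_mult[symmetric] ennreal_leI)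
qed

lemma root_ennreal_finite_iff: "root_ennreal p X < \<infinity> \<longleftrightarrow> X < \<infinity>"
  by (auto simp: root_ennreal_def less_top)

lemma root_ennreal_tendsto_0:
  assumes p: "0 < p" and X: "(\<lambda>n. X n) \<longlonglongrightarrow> (0::ennreal)"
  shows "(\<lambda>n. root_ennreal p (X n)) \<longlonglongrightarrow> 0"
proof (rule order_tendstoI)
  fix a :: ennreal assume "0 < a"
  then obtain b where b: "0 < b" "b < a" using dense by blast
  then obtain e where e: "b = ennreal e" "0 < e" by (cases b) auto
  have "\<forall>\<^sub>F n in sequentially. X n < ennreal (e powr p)"
    using X e by (intro order_tendstoD) auto
  then show "\<forall>\<^sub>F n in sequentially. root_ennreal p (X n) < a"
  proof eventually_elim
    case (elim n)
    obtain x where x: "X n = ennreal x" "0 \<le> x" using elim by (cases "X n") auto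
    have "x \<le> e powr p" using elim x by (simp add: ennreal_less_iff)
    then have "x powr (1 / p) \<le> (e powr p) powr (1 / p)" using p x by (intro powr_mono2) auto
    then have "x powr (1 / p) \<le> e" using p e by (simp add: powr_powr)
    then have "root_ennreal p (X n) \<le> b" using x e by (simp add: root_ennreal_def ennreal_leI)
    then show ?case using b(2) by (rule le_less_trans)
  qed
qed auto

text \<open>
  The first of the four integrals in \<open>Hp_L\<close> is the norm of the slice, so the Hardy norm controls the
  slices uniformly in \<open>(t, s)\<close>.
\<close>

lemma slice_norm_pow_le:
  assumes p: "0 < p" and le: "Hp_norm p \<beta> F \<le> ennreal C * root_ennreal p Y" "Y < \<infinity>"
    and ts: "t \<in> {0..<pi / 2}" "s \<in> {0..<\<beta> - pi / 2}"
  shows "RT_norm_pow p (slice F (s + t) s) \<le> ennreal (max C 0 powr p) * Y"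
proof -
  have "RT_norm_pow p (slice F (s + t) s) \<le> Hp_L p F t s"
    unfolding Hp_L_def by (simp add: add.assoc)
  also have "\<dots> = (\<lambda>(t, s). Hp_L p F t s) (t, s)" by simp
  also have "\<dots> \<le> (SUP (t, s) \<in> {0..<pi / 2} \<times> {0..<\<beta> - pi / 2}. Hp_L p F t s)"
    by (rule SUP_upper) (use ts in auto)
  also have "\<dots> \<le> ennreal (max C 0 powr p) * Y"
    using le unfolding Hp_norm_def by (intro root_ennreal_le_imp p)
  finally show ?thesis .
qed

lemma bdry_Lp_iff:
  "\<phi> \<in> bdry_Lp p \<longleftrightarrow> (\<forall>l\<in>{1..4}. \<phi> l \<in> borel_measurable RT \<and> RT_norm_pow p (\<phi> l) < \<infinity>)"
proof -
  have "{1..4::nat} = {1, 2, 3, 4}" by auto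
  then show ?thesis
    by (auto simp: bdry_Lp_def bdry_norm_def root_ennreal_finite_iff[simplified])
qed

text \<open>
  Dominated convergence with the bound \<open>C / (1 + \<bar>u\<bar>)\<close> of \<open>S_dense_decay\<close>; measurability of the slices
  is inherited from the holomorphic function \<open>S \<psi>\<close>.
\<close>

lemma RT_norm_pow_dense_tendsto:
  assumes \<beta>: "pi / 2 < \<beta>" and p: "1 < p" and S: "S_extension p \<beta> S" and S1: "S1_extension p \<beta> S1"
    and \<psi>: "\<psi> \<in> dense_class" "\<psi> \<in> bdry_Lp p"
    and X: "\<And>n. t n \<in> {0..<pi / 2}" "\<And>n. s n \<in> {0..<\<beta> - pi / 2}"
      "t \<longlonglongrightarrow> pi / 2" "s \<longlonglongrightarrow> \<beta> - pi / 2"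
  shows "(\<lambda>n. RT_norm_pow p (\<lambda>w. S1 \<psi> w - slice (S \<psi>) (s n + t n) (s n) w)) \<longlonglongrightarrow> 0"
proof -
  obtain C where C: "\<And>u v s \<gamma>. v \<in> {0..\<beta>} \<Longrightarrow> s \<in> {0..\<beta> - pi / 2} \<Longrightarrow>
           (1 + \<bar>u\<bar>) * cmod (S_dense \<beta> \<psi> u v (exp (s / 2)) \<gamma>) \<le> C"
    using S_dense_decay[OF \<beta> \<psi>(1)] by blast
  have C0: "0 \<le> C" using order_trans[OF _ C[of 0 0 0 0]] \<beta> pi_gt_zero by simp
  have v: "s n + t n \<in> {0..\<beta>}" "s n \<in> {0..\<beta> - pi / 2}" for n using X(1,2)[of n] by auto
  have slice: "slice (S \<psi>) (s n + t n) (s n) w = S_dense \<beta> \<psi> (fst w) (s n + t n) (exp (s n / 2)) (snd w)" for n w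
    unfolding slice_eq using S \<psi>(1) slice_in_Dprime[OF X(1,2)] by (simp add: S_extension_def)
  show ?thesis
  proof (rule RT_norm_pow_dominated)
    show "slice (S \<psi>) (s n + t n) (s n) \<in> borel_measurable RT" for n
      using S \<psi>(2) X by (intro slice_measurable[of _ p \<beta>]) (auto simp: S_extension_def)
    show "S1 \<psi> \<in> borel_measurable RT"
      using S1 \<psi>(2) by (auto simp: S1_extension_def RT_Lp_def)
    show "(\<lambda>z. C * (1 + \<bar>fst z\<bar>) powr - 1) \<in> borel_measurable RT"
      by measurable
    show "AE z in RT. cmod (slice (S \<psi>) (s n + t n) (s n) z) \<le> C * (1 + \<bar>fst z\<bar>) powr - 1" for n
    proof (rule AE_I2)
      fix z :: "real \<times> real"
      have "(1 + \<bar>fst z\<bar>) * cmod (slice (S \<psi>) (s n + t n) (s n) z) \<le> C"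
        unfolding slice by (rule C) (rule v)+
      then show "cmod (slice (S \<psi>) (s n + t n) (s n) z) \<le> C * (1 + \<bar>fst z\<bar>) powr - 1"
        by (simp add: powr_minus divide_inverse[symmetric] pos_le_divide_eq mult.commute add_pos_nonneg)
    qed
    have "(\<integral>\<^sup>+z. ennreal ((C * (1 + \<bar>fst z\<bar>) powr - 1) powr p) \<partial>RT)
        = (\<integral>\<^sup>+x. ennreal ((C * (1 + \<bar>x\<bar>) powr - 1) powr p) \<partial>lborel)"
      by (rule nn_integral_RT_fst[where w="\<lambda>x. ennreal ((C * (1 + \<bar>x\<bar>) powr - 1) powr p)"]) measurable
    also have "\<dots> = (\<integral>\<^sup>+x. ennreal (C powr p * (1 + \<bar>x\<bar>) powr - p) \<partial>lborel)"
    proof -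
      have "(C * (1 + \<bar>x\<bar>) powr - 1) powr p = C powr p * (1 + \<bar>x\<bar>) powr - p" for x :: real
        unfolding powr_mult powr_powr by simp
      then show ?thesis by simp
    qed
    also have "\<dots> < \<infinity>"
    proof -
      have "integrable lborel (\<lambda>x. C powr p * (1 + \<bar>x\<bar>) powr - p)"
        by (intro integrable_mult_right integrable_one_plus_abs_powr p)
      then show ?thesis by (subst nn_integral_eq_integral) auto
    qed
    finally show "(\<integral>\<^sup>+z. ennreal ((C * (1 + \<bar>fst z\<bar>) powr - 1) powr p) \<partial>RT) < \<infinity>" .
    have "AE w in RT. S1 \<psi> w = S1_dense \<beta> \<psi> (fst w) (snd w)"
      using S1 \<psi>(1) by (auto simp: S1_extension_def)
    then show "AE w in RT. (\<lambda>n. slice (S \<psi>) (s n + t n) (s n) w) \<longlonglongrightarrow> S1 \<psi> w"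
    proof eventually_elim
      case (elim w)
      have "(\<lambda>n. s n + t n) \<longlonglongrightarrow> (\<beta> - pi / 2) + pi / 2" by (intro tendsto_add X)
      then have "(\<lambda>n. s n + t n) \<longlonglongrightarrow> \<beta>" by simp
      from S_dense_tendsto[OF \<beta> \<psi>(1) v(1) this X(4)]
      show ?case unfolding elim slice S1_dense_eq_S_dense .
    qed
  qed (use p in auto)
qed

theorem theorem4p3:
  fixes \<beta> p :: real
    and S :: "(nat \<Rightarrow> real \<times> real \<Rightarrow> complex) \<Rightarrow> complex \<times> complex \<Rightarrow> complex"
    and S1 :: "(nat \<Rightarrow> real \<times> real \<Rightarrow> complex) \<Rightarrow> real \<times> real \<Rightarrow> complex"
    and \<phi> :: "nat \<Rightarrow> real \<times> real \<Rightarrow> complex"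
  assumes "\<beta> > pi / 2"
    and "1 < p"
    and "S_extension p \<beta> S"
    and "S1_extension p \<beta> S1"
    and "\<phi> \<in> bdry_Lp p"
  shows "((\<lambda>(t, s). RT_norm p (\<lambda>w. slice (S \<phi>) (s + t) s w - S1 \<phi> w)) \<longlongrightarrow> 0)
           (at (pi / 2, \<beta> - pi / 2) within {0..<pi / 2} \<times> {0..<\<beta> - pi / 2})"
  unfolding tendsto_at_iff_sequentially
proof (intro allI impI)
  fix X :: "nat \<Rightarrow> real \<times> real"
  assume "\<forall>i. X i \<in> {0..<pi / 2} \<times> {0..<\<beta> - pi / 2} - {(pi / 2, \<beta> - pi / 2)}"
    and lim: "X \<longlonglongrightarrow> (pi / 2, \<beta> - pi / 2)"
  then have dom: "fst (X n) \<in> {0..<pi / 2}" "snd (X n) \<in> {0..<\<beta> - pi / 2}" for n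
    by (auto simp: mem_Times_iff)
  have p: "0 < p" using assms(2) by simp
  let ?v = "\<lambda>n. snd (X n) + fst (X n)"
  define D where "D = 2 powr p"
  have D: "1 \<le> D" unfolding D_def using p by (intro ge_one_powr_ge_zero) auto
  obtain C where C: "\<And>\<phi>. \<phi> \<in> bdry_Lp p \<Longrightarrow> Hp_norm p \<beta> (S \<phi>) \<le> ennreal C * bdry_norm p \<phi>"
    using assms(3) unfolding S_extension_def by blast
  obtain C1 where C1: "\<And>\<phi>. \<phi> \<in> bdry_Lp p \<Longrightarrow> RT_norm p (S1 \<phi>) \<le> ennreal C1 * bdry_norm p \<phi>"
    using assms(4) unfolding S1_extension_def by blast
  define K where "K = max C 0 powr p + max C1 0 powr p"
  have K: "0 \<le> K" by (simp add: K_def)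
  have "(\<lambda>n. RT_norm_pow p (\<lambda>w. slice (S \<phi>) (?v n) (snd (X n)) w - S1 \<phi> w)) \<longlonglongrightarrow> 0"
  proof (rule order_tendstoI)
    fix a :: ennreal assume "0 < a"
    then obtain b where b: "0 < b" "b < a" using dense by blast
    then obtain e where e: "b = ennreal e" "0 < e" by (cases b) auto
    \<comment> \<open>The quasi-triangle inequality is applied twice, to three summands of total size at most \<open>2 \<epsilon>\<close>.\<close>
    define \<epsilon> where "\<epsilon> = e / (4 * D\<^sup>2)"
    have \<epsilon>: "0 < \<epsilon>" using D e by (simp add: \<epsilon>_def)
    define \<delta> where "\<delta> = \<epsilon> / (4 * (K + 1))"
    have \<delta>: "0 < \<delta>" "K * (4 * \<delta>) \<le> \<epsilon>" using \<epsilon> K by (auto simp: \<delta>_def field_simps)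
    have \<phi>m: "\<phi> l \<in> borel_measurable RT" and \<phi>fin: "RT_norm_pow p (\<phi> l) < \<infinity>" if "l \<in> {1..4}" for l
      using assms(5) that by (simp_all add: bdry_Lp_iff)
    have "\<exists>\<psi>\<in>dense_class. \<forall>l\<in>{1..4}. \<psi> l \<in> borel_measurable RT \<and>
        RT_norm_pow p (\<lambda>w. \<phi> l w - \<psi> l w) < ennreal \<delta>"
      by (rule dense_class_dense[OF p \<delta>(1)]) (rule \<phi>m \<phi>fin, assumption)+
    then obtain \<psi> where "\<psi> \<in> dense_class" "\<forall>l\<in>{1..4}. \<psi> l \<in> borel_measurable RT \<and>
        RT_norm_pow p (\<lambda>w. \<phi> l w - \<psi> l w) < ennreal \<delta>"
      by blast
    then have \<psi>: "\<psi> \<in> dense_class" "\<And>l. l \<in> {1..4} \<Longrightarrow> \<psi> l \<in> borel_measurable RT"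
      "\<And>l. l \<in> {1..4} \<Longrightarrow> RT_norm_pow p (\<lambda>w. \<phi> l w - \<psi> l w) < ennreal \<delta>"
      by simp_all
    \<comment> \<open>The scalars 1 and -1 match the form in which linearity of the two operators is given.\<close>
    define \<rho> where "\<rho> = (\<lambda>l w. 1 * \<phi> l w + (-1) * \<psi> l w)"
    have \<rho>_small: "RT_norm_pow p (\<rho> l) < ennreal \<delta>" if "l \<in> {1..4}" for l
      using \<psi>(3)[OF that] by (simp add: \<rho>_def)
    have \<rho>: "\<rho> \<in> bdry_Lp p"
      unfolding bdry_Lp_iff
    proof (intro ballI conjI)
      fix l :: nat assume l: "l \<in> {1..4}"
      show "\<rho> l \<in> borel_measurable RT" unfolding \<rho>_def using \<phi>m[OF l] \<psi>(2)[OF l] by measurable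
      show "RT_norm_pow p (\<rho> l) < \<infinity>" using \<rho>_small[OF l] by (rule less_trans) simp
    qed
    have \<psi>L: "\<psi> \<in> bdry_Lp p"
      unfolding bdry_Lp_iff
    proof (intro ballI conjI)
      fix l :: nat assume l: "l \<in> {1..4}"
      show "\<psi> l \<in> borel_measurable RT" by (rule \<psi>(2)[OF l])
      have "RT_norm_pow p (\<lambda>w. \<phi> l w + - \<rho> l w) \<le> ennreal (2 powr p) * (RT_norm_pow p (\<phi> l) + RT_norm_pow p (\<lambda>w. - \<rho> l w))"
        using \<rho> l \<phi>m by (intro RT_norm_pow_add_le p) (auto simp: bdry_Lp_iff)
      also have "\<dots> < \<infinity>"
        using \<rho> assms(5) l by (auto simp: bdry_Lp_iff RT_norm_pow_minus ennreal_mult_less_top)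
      finally show "RT_norm_pow p (\<psi> l) < \<infinity>" by (simp add: \<rho>_def)
    qed
    define Y where "Y = (\<Sum>l\<in>{1..4}. RT_norm_pow p (\<rho> l))"
    have "Y \<le> (\<Sum>l\<in>{1..4::nat}. ennreal \<delta>)"
      unfolding Y_def using \<rho>_small by (intro sum_mono less_imp_le)
    also have "\<dots> = ennreal (4 * \<delta>)" using \<delta> by (simp add: ennreal_mult flip: ennreal_of_nat_eq_real_of_nat)
    finally have Y: "Y \<le> ennreal (4 * \<delta>)" .
    then have Yfin: "Y < \<infinity>" by (rule le_less_trans) simp
    have norm\<rho>: "bdry_norm p \<rho> = root_ennreal p Y" by (simp add: bdry_norm_def Y_def)
    have A: "RT_norm_pow p (slice (S \<rho>) (?v n) (snd (X n))) \<le> ennreal (max C 0 powr p) * Y" for n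
      by (rule slice_norm_pow_le[OF p C[OF \<rho>, unfolded norm\<rho>] Yfin dom])
    have E: "RT_norm_pow p (S1 \<rho>) \<le> ennreal (max C1 0 powr p) * Y"
      by (rule root_ennreal_le_imp[OF p C1[OF \<rho>, unfolded norm\<rho> RT_norm_def] Yfin])
    \<comment> \<open>Bounds both perturbation terms at once; \<open>K\<close> collects the two operator constants.\<close>
    have AE_sum: "RT_norm_pow p (slice (S \<rho>) (?v n) (snd (X n))) + RT_norm_pow p (S1 \<rho>) \<le> ennreal \<epsilon>" for n
    proof -
      have "RT_norm_pow p (slice (S \<rho>) (?v n) (snd (X n))) + RT_norm_pow p (S1 \<rho>)
         \<le> ennreal (max C 0 powr p) * Y + ennreal (max C1 0 powr p) * Y"
        by (intro add_mono A E)
      also have "\<dots> = ennreal K * Y" by (simp add: K_def ennreal_plus distrib_right)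
      also have "\<dots> \<le> ennreal K * ennreal (4 * \<delta>)" by (intro mult_left_mono Y) simp
      also have "\<dots> = ennreal (K * (4 * \<delta>))" using K \<delta> by (simp add: ennreal_mult)
      also have "\<dots> \<le> ennreal \<epsilon>" by (intro ennreal_leI \<delta>)
      finally show ?thesis .
    qed
    have "(\<lambda>n. RT_norm_pow p (\<lambda>w. S1 \<psi> w - slice (S \<psi>) (?v n) (snd (X n)) w)) \<longlonglongrightarrow> 0"
      using tendsto_fst[OF lim] tendsto_snd[OF lim] dom assms
      by (intro RT_norm_pow_dense_tendsto[of \<beta>] \<psi> \<psi>L) auto
    then have "\<forall>\<^sub>F n in sequentially. RT_norm_pow p (\<lambda>w. S1 \<psi> w - slice (S \<psi>) (?v n) (snd (X n)) w) < ennreal \<epsilon>"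
      using \<epsilon> by (intro order_tendstoD) auto
    then show "\<forall>\<^sub>F n in sequentially. RT_norm_pow p (\<lambda>w. slice (S \<phi>) (?v n) (snd (X n)) w - S1 \<phi> w) < a"
    proof eventually_elim
      case (elim n)
      let ?s = "\<lambda>\<phi>. slice (S \<phi>) (?v n) (snd (X n))"
      have [measurable]: "?s \<phi>' \<in> borel_measurable RT" "S1 \<phi>' \<in> borel_measurable RT" if "\<phi>' \<in> bdry_Lp p" for \<phi>'
        using that assms(3,4) dom[of n]
        by (auto simp: S_extension_def S1_extension_def RT_Lp_def intro: slice_measurable[of _ p \<beta>])
      have S\<rho>: "?s \<rho> w = ?s \<phi> w - ?s \<psi> w" for w
      proof -
        have "S \<rho> z = 1 * S \<phi> z + (-1) * S \<psi> z" if "z \<in> Dprime \<beta>" for z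
          using assms(3,5) \<psi>L that unfolding S_extension_def \<rho>_def by blast
        then show ?thesis unfolding slice_eq using slice_in_Dprime[OF dom] by simp
      qed
      have "AE w in RT. S1 \<rho> w = 1 * S1 \<phi> w + (-1) * S1 \<psi> w"
        using assms(4,5) \<psi>L unfolding S1_extension_def \<rho>_def by blast
      \<comment> \<open>The difference is split into the perturbation \<open>\<rho>\<close> and the convergence on the dense class.\<close>
      then have "AE w in RT. ?s \<phi> w - S1 \<phi> w = (?s \<rho> w + - S1 \<rho> w) + (?s \<psi> w - S1 \<psi> w)"
        by eventually_elim (simp add: S\<rho>)
      then have "RT_norm_pow p (\<lambda>w. ?s \<phi> w - S1 \<phi> w) = RT_norm_pow p (\<lambda>w. (?s \<rho> w + - S1 \<rho> w) + (?s \<psi> w - S1 \<psi> w))"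
        by (rule RT_norm_pow_cong_AE)
      also have "\<dots> \<le> ennreal D * (RT_norm_pow p (\<lambda>w. ?s \<rho> w + - S1 \<rho> w) + RT_norm_pow p (\<lambda>w. ?s \<psi> w - S1 \<psi> w))"
        unfolding D_def using \<rho> \<psi>L by (intro RT_norm_pow_add_le p) measurable
      also have "\<dots> \<le> ennreal D * (ennreal D * ennreal \<epsilon> + ennreal D * ennreal \<epsilon>)"
      proof (intro mult_left_mono add_mono)
        have "RT_norm_pow p (\<lambda>w. ?s \<rho> w + - S1 \<rho> w) \<le> ennreal D * (RT_norm_pow p (?s \<rho>) + RT_norm_pow p (\<lambda>w. - S1 \<rho> w))"
          unfolding D_def using \<rho> by (intro RT_norm_pow_add_le p) measurable
        also have "\<dots> \<le> ennreal D * ennreal \<epsilon>"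
          using AE_sum[of n] by (intro mult_left_mono) (auto simp: RT_norm_pow_minus)
        finally show "RT_norm_pow p (\<lambda>w. ?s \<rho> w + - S1 \<rho> w) \<le> ennreal D * ennreal \<epsilon>" .
        have "RT_norm_pow p (\<lambda>w. ?s \<psi> w - S1 \<psi> w) = RT_norm_pow p (\<lambda>w. S1 \<psi> w - ?s \<psi> w)"
          using RT_norm_pow_minus[of p "\<lambda>w. S1 \<psi> w - ?s \<psi> w"] by simp
        also have "\<dots> \<le> ennreal (1 * \<epsilon>)" using elim by simp
        also have "\<dots> \<le> ennreal (D * \<epsilon>)" using D \<epsilon> by (intro ennreal_leI mult_right_mono) auto
        finally show "RT_norm_pow p (\<lambda>w. ?s \<psi> w - S1 \<psi> w) \<le> ennreal D * ennreal \<epsilon>"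
          using D \<epsilon> by (simp add: ennreal_mult)
      qed auto
      also have "\<dots> = ennreal (e / 2)"
        using D \<epsilon> by (simp add: ennreal_mult[symmetric] ennreal_plus[symmetric] \<epsilon>_def power2_eq_square field_simps del: ennreal_plus)
      also have "\<dots> < a" using b e by (metis ennreal_lessI field_sum_of_halves less_add_same_cancel1 half_gt_zero less_trans)
      finally show ?case .
    qed
  qed auto
  then show "((\<lambda>(t, s). RT_norm p (\<lambda>w. slice (S \<phi>) (s + t) s w - S1 \<phi> w)) \<circ> X) \<longlonglongrightarrow> 0"
    unfolding comp_def split_beta RT_norm_def by (rule root_ennreal_tendsto_0[OF p])
qed

end
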